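(* Let $\theta\in(0,1)$ be irrational with convergent denominators $q_k$ ($k\ge0$, $q_0=1$). (i) If there is a constant $C$ such that $q_k\le C^k$ for all $k$, then for every monotone increasing positive function $\varphi$ on the positive integers with $\sum_{n=1}^\infty \frac{1}{n\varphi(n)}=\infty$ we have $$\liminf_{n\to\infty} n\,\varphi(n)\,\|n\theta-s\| = 0\quad\text{for almost every } s\in\mathbb{R}.$$ (ii) If there is a constant $D$ such that $q_{k+1}/q_k\le D\log q_k$ for all sufficiently large $k$, then for every monotone increasing positive function $\varphi$ on the positive integers with $\sum_{n=1}^\infty \frac{1}{n\varphi(n)}=\infty$ we have $$\liminf_{n\to\infty} n\,\varphi(n)\,\|n\theta-s\| = 0\quad\text{for almost every } s\in\mathbb{R}.$$
   Context: For $t\in\mathbb{R}$, $\|t\|$ denotes the distance from $t$ to the nearest integer. For an irrational $\theta\in(0,1)$ with continued fraction partial quotients $a_1,a_2,\dots$, the convergent denominators are defined by $q_0=1$, $q_1=a_1$, $q_{k+1}=a_{k+1}q_k+q_{k-1}$. "Almost every" refers to Lebesgue measure. *)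

theory Defs
  imports "HOL-Analysis.Analysis"
begin

definition dist_int :: "real \<Rightarrow> real" where
  "dist_int t = \<bar>t - of_int (round t)\<bar>"

text \<open>
  Complete remainders of the continued fraction algorithm, for \<open>\<theta>\<close> in the open unit interval:
  \<open>cf_rem \<theta> k = [0; a\<^sub>k\<^sub>+\<^sub>1, a\<^sub>k\<^sub>+\<^sub>2, \<dots>]\<close>, i.e. the iterates of \<open>\<theta>\<close> under the Gauss map.
\<close>
primrec cf_rem :: "real \<Rightarrow> nat \<Rightarrow> real" where
  "cf_rem \<theta> 0 = \<theta>"
| "cf_rem \<theta> (Suc k) = frac (1 / cf_rem \<theta> k)"

text \<open>
  Partial quotients are indexed from 1, as in \<open>\<theta> = [0; a\<^sub>1, a\<^sub>2, \<dots>]\<close>. The value at index 0 has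
  no meaning and is never used.
\<close>
definition cf_quot :: "real \<Rightarrow> nat \<Rightarrow> nat" where
  "cf_quot \<theta> k = nat \<lfloor>1 / cf_rem \<theta> (k - 1)\<rfloor>"

fun cf_denom :: "real \<Rightarrow> nat \<Rightarrow> nat" where
  "cf_denom \<theta> 0 = 1"
| "cf_denom \<theta> (Suc 0) = cf_quot \<theta> 1"
| "cf_denom \<theta> (Suc (Suc k)) = cf_quot \<theta> (Suc (Suc k)) * cf_denom \<theta> (Suc k) + cf_denom \<theta> k"

lemma cf_rem_bounds:
  assumes "\<theta> \<notin> \<rat>" "0 < \<theta>" "\<theta> < 1"
  shows "cf_rem \<theta> k \<notin> \<rat> \<and> 0 < cf_rem \<theta> k \<and> cf_rem \<theta> k < 1"
proof (induction k)
  case 0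
  show ?case using assms by simp
next
  case (Suc k)
  let ?y = "1 / cf_rem \<theta> k"
  have y: "?y \<notin> \<rat>"
    using Suc Rats_inverse[of ?y] by (auto simp: field_simps)
  have "frac ?y \<notin> \<rat>"
  proof
    assume "frac ?y \<in> \<rat>"
    then have "frac ?y + of_int \<lfloor>?y\<rfloor> \<in> \<rat>" by (intro Rats_add) auto
    with y show False by (simp add: frac_def)
  qed
  then show ?case
    using frac_ge_0[of ?y] frac_lt_1[of ?y] by (metis Rats_0 cf_rem.simps(2) less_le)
qed

lemma cf_rem_step:
  assumes "\<theta> \<notin> \<rat>" "0 < \<theta>" "\<theta> < 1"
  shows "cf_quot \<theta> (Suc k) \<ge> 1"
    and "cf_rem \<theta> k = 1 / (real (cf_quot \<theta> (Suc k)) + cf_rem \<theta> (Suc k))"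
proof -
  have b: "0 < cf_rem \<theta> k" "cf_rem \<theta> k < 1"
    using cf_rem_bounds[OF assms] by auto
  then have "1 \<le> 1 / cf_rem \<theta> k" by (simp add: field_simps)
  then have f: "1 \<le> \<lfloor>1 / cf_rem \<theta> k\<rfloor>" by (simp add: le_floor_iff)
  then show "cf_quot \<theta> (Suc k) \<ge> 1"
    unfolding cf_quot_def diff_Suc_1 by linarith
  have "real (cf_quot \<theta> (Suc k)) + cf_rem \<theta> (Suc k) = 1 / cf_rem \<theta> k"
    unfolding cf_quot_def diff_Suc_1 cf_rem.simps(2) frac_def using f by linarith
  then show "cf_rem \<theta> k = 1 / (real (cf_quot \<theta> (Suc k)) + cf_rem \<theta> (Suc k))" by simp
qed

end

theory Submission
  imports Defs
begin

text \<open>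
  For \<open>\<epsilon> > 0\<close> let \<open>W\<close> be the set of \<open>s\<close> with \<open>n \<phi>(n) \<parallel>n\<theta> - s\<parallel> < \<epsilon>\<close> for infinitely many \<open>n\<close>. As \<open>n \<phi>(n)\<close>
  increases, \<open>W - \<theta> \<subseteq> W\<close>, and \<open>W\<close> is 1-periodic; hence the measure of \<open>W \<inter> [a, a + L)\<close> does not
  increase along the dense set \<open>a + n\<theta> + m\<close>, so it does not depend on \<open>a\<close>, is linear in \<open>L\<close>, and \<open>W\<close>
  is null or conull.

  That \<open>W\<close> is not null follows from a second moment bound for the arcs of radius
  \<open>r\<^sub>t = \<epsilon> / (2 N\<^sub>t \<phi>(2 N\<^sub>t))\<close> around \<open>n\<theta>\<close>, \<open>N\<^sub>t \<le> n < 2 N\<^sub>t\<close>, where \<open>N\<^sub>t\<close> is a sequence of scales with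
  \<open>\<Sum> N\<^sub>t r\<^sub>t = \<infinity>\<close>. The correlations are controlled by counting orbit points in short arcs, and
  this only uses \<open>\<parallel>l\<theta>\<parallel> \<ge> 1 / (2 q\<^sub>k)\<close> for \<open>0 < l < q\<^sub>k\<close>. In (i) the scales are \<open>N\<^sub>k = q\<^sub>k\<close>, and the sum
  diverges because \<open>\<Sum> 1 / \<phi>(M\<^sup>k) = \<infinity>\<close>. In (ii) the scales are powers of 2. There one may replace \<open>\<phi>\<close> by
  \<open>max \<phi> ln\<close> without losing divergence, and then \<open>r\<^sub>t\<close> is so small that for
  \<open>q\<^sub>k \<le> 2 N\<^sub>t < q\<^sub>k\<^sub>+\<^sub>1\<close> the arcs of one such block have bounded overlap.
\<close>


section \<open>The distance to the nearest integer\<close>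

lemma dist_int_le: "dist_int t \<le> \<bar>t - of_int m\<bar>"
  unfolding dist_int_def by (rule round_diff_minimal)

lemma dist_int_nonneg [simp]: "0 \<le> dist_int t"
  by (simp add: dist_int_def)

lemma dist_int_add_int [simp]: "dist_int (t + of_int m) = dist_int t"
proof (rule antisym)
  have "dist_int (t + of_int m) \<le> \<bar>t + of_int m - of_int (round t + m)\<bar>" by (rule dist_int_le)
  then show "dist_int (t + of_int m) \<le> dist_int t" by (simp add: dist_int_def)
  have "dist_int t \<le> \<bar>t - of_int (round (t + of_int m) - m)\<bar>" by (rule dist_int_le)
  also have "\<dots> = dist_int (t + of_int m)" by (simp add: dist_int_def algebra_simps)
  finally show "dist_int t \<le> dist_int (t + of_int m)" .
qed

lemma dist_int_diff_le: "dist_int (a - b) \<le> dist_int a + dist_int b"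
  using dist_int_le[of "a - b" "round a - round b"] by (simp add: dist_int_def)

lemma borel_measurable_dist_int [measurable]: "dist_int \<in> borel_measurable borel"
  unfolding dist_int_def round_def by measurable

section \<open>Convergents\<close>

text \<open>Numerators of the convergents; they start with 0 and 1 because \<theta> has integer part
  0.\<close>

fun cf_num :: "real \<Rightarrow> nat \<Rightarrow> nat" where
  "cf_num \<theta> 0 = 0"
| "cf_num \<theta> (Suc 0) = 1"
| "cf_num \<theta> (Suc (Suc k)) = cf_quot \<theta> (Suc (Suc k)) * cf_num \<theta> (Suc k) + cf_num \<theta> k"

lemma cf_det: "int (cf_num \<theta> (Suc k) * cf_denom \<theta> k) - int (cf_num \<theta> k * cf_denom \<theta> (Suc k)) = (- 1) ^ k"
  by (induction k) (simp_all add: algebra_simps)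

context
  fixes \<theta> :: real
  assumes irr: "\<theta> \<notin> \<rat>" and pos: "0 < \<theta>" and less1: "\<theta> < 1"
begin

lemma cf_rem_eq: "cf_rem \<theta> k * (real (cf_quot \<theta> (Suc k)) + cf_rem \<theta> (Suc k)) = 1"
proof -
  have "0 < real (cf_quot \<theta> (Suc k)) + cf_rem \<theta> (Suc k)"
    using cf_rem_bounds[OF irr pos less1, of "Suc k"] by linarith
  then show ?thesis by (subst cf_rem_step(2)[OF irr pos less1, of k]) simp
qed

text \<open>Both sides obey the three-term recurrence of the convergents; \<open>cf_rem_eq\<close>
  supplies this for the product. Sign and size of the approximation error can then be read off
  separately.\<close>

lemma cf_error:
  "real (cf_denom \<theta> k) * \<theta> - real (cf_num \<theta> k) = (- 1) ^ k * (\<Prod>i\<le>k. cf_rem \<theta> i)"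
proof (induction k rule: induct_nat_012)
  case 0
  show ?case by simp
next
  case 1
  show ?case using cf_rem_eq[of 0] by (simp add: algebra_simps)
next
  case (ge2 n)
  let ?a = "real (cf_quot \<theta> (Suc (Suc n)))"
  let ?P = "\<Prod>i\<le>n. cf_rem \<theta> i"
  have "real (cf_denom \<theta> (Suc (Suc n))) * \<theta> - real (cf_num \<theta> (Suc (Suc n)))
      = ?a * (real (cf_denom \<theta> (Suc n)) * \<theta> - real (cf_num \<theta> (Suc n)))
        + (real (cf_denom \<theta> n) * \<theta> - real (cf_num \<theta> n))"
    by (simp add: algebra_simps)
  also have "\<dots> = (- 1) ^ n * ?P * (1 - ?a * cf_rem \<theta> (Suc n))"
    unfolding ge2 by (simp add: algebra_simps)
  also have "1 - ?a * cf_rem \<theta> (Suc n) = cf_rem \<theta> (Suc n) * cf_rem \<theta> (Suc (Suc n))"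
    using cf_rem_eq[of "Suc n"] by (simp add: algebra_simps)
  finally show ?case by simp
qed

lemma cf_denom_pos [simp]: "0 < cf_denom \<theta> k"
proof (induction k rule: induct_nat_012)
  case 1
  show ?case using cf_rem_step(1)[OF irr pos less1, of 0] by simp
qed auto

lemma cf_denom_fib: "cf_denom \<theta> (Suc k) + cf_denom \<theta> k \<le> cf_denom \<theta> (Suc (Suc k))"
  using mult_le_mono1[OF cf_rem_step(1)[OF irr pos less1, of "Suc k"], of "cf_denom \<theta> (Suc k)"]
  by simp

lemma cf_denom_Suc_ge: "cf_denom \<theta> k \<le> cf_denom \<theta> (Suc k)"
proof (cases k)
  case 0
  then show ?thesis using cf_rem_step(1)[OF irr pos less1, of 0] by simp
next
  case (Suc j)
  show ?thesis unfolding Suc using cf_denom_fib[of j] by linarith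
qed

lemma mono_cf_denom: "mono (cf_denom \<theta>)"
  using cf_denom_Suc_ge by (simp add: mono_iff_le_Suc)

lemma cf_denom_ge: "k \<le> cf_denom \<theta> k"
proof (induction k rule: induct_nat_012)
  case 1
  show ?case using cf_denom_pos[of "Suc 0"] by linarith
next
  case (ge2 n)
  then show ?case using cf_denom_fib[of n] cf_denom_pos[of n] by linarith
qed auto

text \<open>Denominators grow at least like Fibonacci numbers, so the last term dominates the sum.
  The factor 3 becomes the constant \<open>K\<close> of the correlation bound in case (i).\<close>

lemma sum_cf_denom_le: "(\<Sum>i\<le>k. cf_denom \<theta> i) \<le> 3 * cf_denom \<theta> k"
proof (induction k rule: induct_nat_012)
  case 1
  show ?case using cf_denom_Suc_ge[of 0] by simp
next
  case (ge2 n)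
  then show ?case
    unfolding sum.atMost_Suc using cf_denom_fib[of n] cf_denom_Suc_ge[of n] by linarith
qed auto

text \<open>This is the determinant identity \<open>cf_det\<close> written with the errors of the
  convergents. Consecutive errors have opposite signs, which turns the difference into a sum of
  positive terms.\<close>

lemma cf_error_sum:
  "real (cf_denom \<theta> (Suc k)) * (\<Prod>i\<le>k. cf_rem \<theta> i)
     + real (cf_denom \<theta> k) * (\<Prod>i\<le>Suc k. cf_rem \<theta> i) = 1"
proof -
  let ?q = "\<lambda>k. real (cf_denom \<theta> k)" and ?p = "\<lambda>k. real (cf_num \<theta> k)"
  let ?P = "\<lambda>k. \<Prod>i\<le>k. cf_rem \<theta> i"
  have "(- 1) ^ k * (?q (Suc k) * ?P k + ?q k * ?P (Suc k))
      = ?q (Suc k) * ((- 1) ^ k * ?P k) - ?q k * ((- 1) ^ Suc k * ?P (Suc k))"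
    by (simp add: algebra_simps)
  also have "\<dots> = ?p (Suc k) * ?q k - ?p k * ?q (Suc k)"
    unfolding cf_error[symmetric] by (simp add: algebra_simps)
  also have "\<dots> = (- 1) ^ k"
    using arg_cong[OF cf_det[of \<theta> k], of real_of_int] by simp
  finally show ?thesis by simp
qed

text \<open>Best approximation: for \<open>k = Suc j\<close>, two consecutive pairs (denominator,
  numerator) form a basis of the integer lattice. In this basis the pair of \<open>l\<close> and its
  nearest integer \<open>m\<close> has coordinates \<open>u\<close>, \<open>v\<close>. The
  contributions of the two errors reinforce each other, so the distance is at least the error
  \<open>P j\<close>.\<close>

lemma dist_int_mult_ge:
  fixes l :: int
  assumes l: "0 < l" "l < int (cf_denom \<theta> k)"
  shows "1 / (2 * real (cf_denom \<theta> k)) \<le> dist_int (of_int l * \<theta>)"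
proof -
  obtain j where k: "k = Suc j"
    using l by (cases k) auto
  define q where "q = (\<lambda>k. int (cf_denom \<theta> k))"
  define p where "p = (\<lambda>k. int (cf_num \<theta> k))"
  define P where "P = (\<lambda>k. \<Prod>i\<le>k. cf_rem \<theta> i)"
  define m where "m = round (of_int l * \<theta>)"
  define s :: int where "s = (- 1) ^ j"
  \<comment> \<open>Cramer's rule; the determinant \<open>s\<close> is 1 or -1, so it is its own
    inverse and the coordinates are integers.\<close>
  define u where "u = s * (l * p (Suc j) - m * q (Suc j))"
  define v where "v = s * (m * q j - l * p j)"
  have s: "s * s = 1" by (simp add: s_def flip: power_add)
  have det: "p (Suc j) * q j - p j * q (Suc j) = s"
    using cf_det[of \<theta> j] by (simp add: p_def q_def s_def)
  have lu: "l = u * q j + v * q (Suc j)"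
  proof -
    have "u * q j + v * q (Suc j) = s * l * (p (Suc j) * q j - p j * q (Suc j))"
      by (simp add: u_def v_def algebra_simps)
    then show ?thesis using det s by (simp add: algebra_simps)
  qed
  have mu: "m = u * p j + v * p (Suc j)"
  proof -
    have "u * p j + v * p (Suc j) = s * m * (p (Suc j) * q j - p j * q (Suc j))"
      by (simp add: u_def v_def algebra_simps)
    then show ?thesis using det s by (simp add: algebra_simps)
  qed
  have qpos: "0 < q j" "0 < q (Suc j)" by (simp_all add: q_def)
  have Ppos: "0 < P i" for i
    unfolding P_def using cf_rem_bounds[OF irr pos less1] by (intro prod_pos) auto
  have PS: "P (Suc j) \<le> P j"
  proof -
    have "P (Suc j) = P j * cf_rem \<theta> (Suc j)" by (simp add: P_def)
    then show ?thesis
      using mult_left_mono[of "cf_rem \<theta> (Suc j)" 1 "P j"] Ppos[of j]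
        cf_rem_bounds[OF irr pos less1, of "Suc j"] by simp
  qed
  have err: "of_int (q i) * \<theta> - of_int (p i) = (- 1) ^ i * P i" for i
    using cf_error[of i] by (simp add: q_def p_def P_def)
  have "of_int l * \<theta> - of_int m
      = of_int u * (of_int (q j) * \<theta> - of_int (p j)) + of_int v * (of_int (q (Suc j)) * \<theta> - of_int (p (Suc j)))"
    by (subst lu, subst mu) (simp add: algebra_simps)
  also have "\<dots> = (- 1) ^ j * (of_int u * P j - of_int v * P (Suc j))"
    unfolding err by (simp add: algebra_simps)
  finally have "dist_int (of_int l * \<theta>) = \<bar>(- 1) ^ j * (of_int u * P j - of_int v * P (Suc j))\<bar>"
    by (simp add: dist_int_def m_def)
  then have d: "dist_int (of_int l * \<theta>) = \<bar>of_int u * P j - of_int v * P (Suc j)\<bar>"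
    by (simp add: abs_mult)
  \<comment> \<open>The two summands cannot cancel: \<open>0 < l < q\<^sub>j\<^sub>+\<^sub>1\<close> forces \<open>u \<noteq> 0\<close> and \<open>u v \<le> 0\<close>.\<close>
  have lq: "l < q (Suc j)" using l k by (simp add: q_def)
  have uv: "u \<ge> 1 \<and> v \<le> 0 \<or> u \<le> -1 \<and> v \<ge> 0"
  proof (cases "v \<ge> 1")
    case True
    then have "q (Suc j) \<le> v * q (Suc j)" using qpos by simp
    then have "u * q j < 0" using lu lq by linarith
    then show ?thesis using qpos True by (auto simp: mult_less_0_iff)
  next
    case False
    then have "v * q (Suc j) \<le> 0" using qpos by (simp add: mult_le_0_iff)
    then have "0 < u * q j" using lu l by linarith
    then show ?thesis using qpos False by (auto simp: zero_less_mult_iff)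
  qed
  have "P j \<le> dist_int (of_int l * \<theta>)"
    using uv
  proof
    assume *: "u \<ge> 1 \<and> v \<le> 0"
    then have "P j \<le> of_int u * P j" "of_int v * P (Suc j) \<le> 0"
      using Ppos[of j] Ppos[of "Suc j"] by (auto simp: mult_le_0_iff)
    then show ?thesis unfolding d by linarith
  next
    assume *: "u \<le> -1 \<and> v \<ge> 0"
    then have "P j \<le> of_int (- u) * P j" "of_int v * P (Suc j) \<ge> 0"
      using Ppos[of j] Ppos[of "Suc j"] mult_right_mono[of 1 "of_int (- u)" "P j"] by auto
    then show ?thesis unfolding d by simp
  qed
  \<comment> \<open>Of the two terms in \<open>cf_error_sum\<close>, which add up to 1, the first is
    the larger.\<close>
  moreover have "1 / (2 * real (cf_denom \<theta> k)) \<le> P j"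
  proof -
    have "1 = of_int (q (Suc j)) * P j + of_int (q j) * P (Suc j)"
      using cf_error_sum[of j] by (simp add: P_def q_def)
    also have "of_int (q j) * P (Suc j) \<le> of_int (q (Suc j)) * P j"
      using cf_denom_Suc_ge[of j] PS Ppos[of "Suc j"] by (intro mult_mono) (auto simp: q_def)
    finally have "1 \<le> 2 * real (cf_denom \<theta> k) * P j" by (simp add: k q_def mult.commute)
    then show ?thesis
      using qpos by (simp add: k q_def field_simps)
  qed
  ultimately show ?thesis by linarith
qed

end

section \<open>Counting orbit points in short arcs\<close>

text \<open>Cut the interval into cells of length \<open>d\<close>: \<open>g\<close> is the index of
  the cell, and by separation no cell holds two of the points.\<close>

lemma card_separated_le:
  fixes y :: "nat \<Rightarrow> real"
  assumes fin: "finite S" and d: "0 < d" and \<rho>: "0 < \<rho>"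
    and bd: "\<And>n. n \<in> S \<Longrightarrow> \<bar>y n\<bar> < \<rho>"
    and sep: "\<And>m n. m \<in> S \<Longrightarrow> n \<in> S \<Longrightarrow> m < n \<Longrightarrow> d \<le> \<bar>y n - y m\<bar>"
  shows "real (card S) \<le> 2 * \<rho> / d + 1"
proof -
  define g where "g n = \<lfloor>(y n + \<rho>) / d\<rfloor>" for n
  have inj: "inj_on g S"
  proof (rule inj_onI)
    fix m n assume mn: "m \<in> S" "n \<in> S" "g m = g n"
    have *: "d \<le> \<bar>y n - y m\<bar>" if "m \<noteq> n"
      using sep[OF mn(1,2)] sep[OF mn(2,1)] that by (cases m n rule: linorder_cases) auto
    have "\<bar>(y n + \<rho>) / d - (y m + \<rho>) / d\<bar> < 1"
      using mn(3) unfolding g_def by linarith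
    then have "\<bar>(y n - y m) / d\<bar> < 1" by (simp add: diff_divide_distrib add_divide_distrib)
    then have "\<bar>y n - y m\<bar> < d" using d by (simp add: abs_divide)
    then show "m = n" using * by linarith
  qed
  have "g ` S \<subseteq> {0..\<lfloor>2 * \<rho> / d\<rfloor>}"
  proof (rule image_subsetI)
    fix n assume "n \<in> S"
    then have "0 \<le> (y n + \<rho>) / d" "(y n + \<rho>) / d \<le> 2 * \<rho> / d"
      using bd[of n] d by (auto intro!: divide_right_mono)
    then show "g n \<in> {0..\<lfloor>2 * \<rho> / d\<rfloor>}" unfolding g_def by (auto intro: floor_mono)
  qed
  then have "card (g ` S) \<le> card {0..\<lfloor>2 * \<rho> / d\<rfloor>}" by (intro card_mono) auto
  then have "card S \<le> nat (\<lfloor>2 * \<rho> / d\<rfloor> + 1)" by (simp add: card_image inj)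
  moreover have "0 \<le> 2 * \<rho> / d" using d \<rho> by simp
  ultimately show ?thesis by linarith
qed

text \<open>The only Diophantine information that the counting uses, detached from continued
  fractions; every convergent denominator has this property.\<close>

definition separating :: "real \<Rightarrow> nat \<Rightarrow> bool" where
  "separating \<theta> q \<longleftrightarrow> 0 < q \<and>
     (\<forall>l::nat. 0 < l \<and> l < q \<longrightarrow> 1 / (2 * real q) \<le> dist_int (real l * \<theta>))"

text \<open>Indices in the window differ by less than \<open>q\<close>, so the corresponding orbit
  points are \<open>1 / (2 * q)\<close> apart and \<open>card_separated_le\<close> applies.\<close>

lemma card_window_le:
  assumes q: "separating \<theta> q" and \<rho>: "0 < \<rho>" and h: "h \<le> q"
  shows "real (card {n \<in> {N..<N + h}. dist_int (real n * \<theta> - x) < \<rho>}) \<le> 4 * \<rho> * real q + 1"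
proof -
  \<comment> \<open>The signed representative of the point modulo 1 that is nearest to 0, so that
    its absolute value is the distance.\<close>
  define y where "y n = real n * \<theta> - x - of_int (round (real n * \<theta> - x))" for n
  have q0: "0 < real q" using q by (simp add: separating_def)
  have "real (card {n \<in> {N..<N + h}. dist_int (real n * \<theta> - x) < \<rho>}) \<le> 2 * \<rho> / (1 / (2 * real q)) + 1"
  proof (rule card_separated_le[where y = y])
    fix m n assume mn: "m \<in> {n \<in> {N..<N + h}. dist_int (real n * \<theta> - x) < \<rho>}"
      "n \<in> {n \<in> {N..<N + h}. dist_int (real n * \<theta> - x) < \<rho>}" "m < n"
    then have "1 / (2 * real q) \<le> dist_int (real (n - m) * \<theta>)"
      using q h by (auto simp: separating_def simp del: of_nat_diff)
    also have "\<dots> \<le> \<bar>y n - y m\<bar>"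
      using dist_int_le[of "real (n - m) * \<theta>" "round (real n * \<theta> - x) - round (real m * \<theta> - x)"] mn(3)
      by (simp add: y_def of_nat_diff algebra_simps)
    finally show "1 / (2 * real q) \<le> \<bar>y n - y m\<bar>" .
  qed (use \<rho> q0 in \<open>auto simp: y_def dist_int_def\<close>)
  then show ?thesis by (simp add: algebra_simps)
qed

text \<open>Windows of length \<open>q\<close> are split off one at a time; \<open>h / q + 1\<close>
  bounds their number.\<close>

lemma card_long_window_le:
  assumes q: "separating \<theta> q" and \<rho>: "0 < \<rho>"
  shows "real (card {n \<in> {N..<N + h}. dist_int (real n * \<theta> - x) < \<rho>})
           \<le> (real h / real q + 1) * (4 * \<rho> * real q + 1)"
proof (induction h arbitrary: N rule: less_induct)
  case (less h)
  have q0: "0 < q" using q by (simp add: separating_def)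
  let ?A = "\<lambda>N h. {n \<in> {N..<N + h}. dist_int (real n * \<theta> - x) < \<rho>}"
  let ?c = "4 * \<rho> * real q + 1"
  have c: "0 \<le> ?c" using \<rho> by simp
  show ?case
  proof (cases "h \<le> q")
    case True
    have "?c \<le> (real h / real q + 1) * ?c"
      using mult_right_mono[of 1 "real h / real q + 1" ?c] c by simp
    then show ?thesis using card_window_le[OF q \<rho> True, of N x] by linarith
  next
    case False
    have "?A N h \<subseteq> ?A N q \<union> ?A (N + q) (h - q)" by auto
    then have "card (?A N h) \<le> card (?A N q \<union> ?A (N + q) (h - q))" by (intro card_mono) auto
    also have "\<dots> \<le> card (?A N q) + card (?A (N + q) (h - q))" by (rule card_Un_le)
    finally have "real (card (?A N h)) \<le> real (card (?A N q)) + real (card (?A (N + q) (h - q)))"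
      by linarith
    also have "\<dots> \<le> ?c + (real (h - q) / real q + 1) * ?c"
      using False q0 by (intro add_mono less.IH card_window_le[OF q \<rho>]) auto
    also have "real (h - q) / real q = real h / real q - 1"
      using False q0 by (simp add: of_nat_diff diff_divide_distrib)
    finally show ?thesis by (simp add: algebra_simps)
  qed
qed

lemma separating_cf_denom:
  assumes "\<theta> \<notin> \<rat>" "0 < \<theta>" "\<theta> < 1"
  shows "separating \<theta> (cf_denom \<theta> k)"
  unfolding separating_def
proof (intro conjI allI impI)
  fix l :: nat assume "0 < l \<and> l < cf_denom \<theta> k"
  then show "1 / (2 * real (cf_denom \<theta> k)) \<le> dist_int (real l * \<theta>)"
    using dist_int_mult_ge[OF assms, of "int l" k] by simp
qed (rule cf_denom_pos[OF assms])


section \<open>A zero-one law for irrational rotations\<close>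

lemma measure_lborel_shift:
  fixes X :: "real set"
  assumes "X \<in> sets borel"
  shows "measure lborel {s. s + c \<in> X} = measure lborel X"
proof -
  have "measure lborel X = measure (distr lborel borel ((+) c)) X"
    by (simp add: lborel_distr_plus)
  also have "\<dots> = measure lborel ((+) c -` X)"
    using assms by (subst measure_distr) auto
  also have "(+) c -` X = {s. s + c \<in> X}" by (auto simp: add.commute)
  finally show ?thesis by simp
qed

text \<open>One-sided invariance is enough: the measure of \<open>W\<close> in a moving window
  decreases along a dense orbit and depends continuously on the window, hence is constant. So
  \<open>W\<close> has the same density \<open>c\<close> in every interval, and comparing measures
  on intervals forces its complement to be null.\<close>

lemma rotation_zero_one:
  fixes W :: "real set"
  assumes irr: "\<theta> \<notin> \<rat>" and W [measurable]: "W \<in> sets borel"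
    and rot: "\<And>s. s \<in> W \<Longrightarrow> s - \<theta> \<in> W"
    and per: "\<And>s. s \<in> W \<Longrightarrow> s + 1 \<in> W" "\<And>s. s \<in> W \<Longrightarrow> s - 1 \<in> W"
    and pos: "emeasure lborel W \<noteq> 0"
  shows "AE s in lborel. s \<in> W"
proof -
  define F where "F a L = measure lborel (W \<inter> {a..<a + L})" for a L
  have fm: "W \<inter> {a..<b} \<in> fmeasurable lborel" for a b
  proof (rule fmeasurableI2[of "{a..<b}"])
    show "{a..<b} \<in> fmeasurable lborel" by (cases "a \<le> b") (auto intro!: fmeasurableI)
  qed auto
  have int_shift: "s + of_int m \<in> W \<Longrightarrow> s \<in> W" for s and m :: int
  proof (induction m arbitrary: s rule: int_induct[where k = 0])
    case base
    then show ?case by simp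
  next
    case (step1 i)
    then show ?case using per(2)[of "s + of_int (i + 1)"] by (simp add: algebra_simps)
  next
    case (step2 i)
    then show ?case using per(1)[of "s + of_int (i - 1)"] by (simp add: algebra_simps)
  qed
  have nat_shift: "s + real n * \<theta> \<in> W \<Longrightarrow> s \<in> W" for s n
  proof (induction n arbitrary: s)
    case (Suc n)
    then show ?case using rot[of "s + real (Suc n) * \<theta>"] by (simp add: algebra_simps)
  qed simp
  have F_orbit: "F (a + real n * \<theta> + of_int m) L \<le> F a L" for a n m L
  proof -
    let ?c = "real n * \<theta> + of_int m"
    have "F (a + ?c) L = measure lborel {s. s + ?c \<in> W \<inter> {a + ?c..<a + ?c + L}}"
      unfolding F_def by (rule measure_lborel_shift[symmetric]) simp
    also have "\<dots> \<le> F a L"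
      unfolding F_def
    proof (rule measure_mono_fmeasurable[OF _ _ fm])
      show "{s. s + ?c \<in> W \<inter> {a + ?c..<a + ?c + L}} \<subseteq> W \<inter> {a..<a + L}"
      proof
        fix s assume s: "s \<in> {s. s + ?c \<in> W \<inter> {a + ?c..<a + ?c + L}}"
        then have "(s + real n * \<theta>) + of_int m \<in> W" by (simp add: add.assoc)
        then have "s \<in> W" using int_shift nat_shift by blast
        then show "s \<in> W \<inter> {a..<a + L}" using s by auto
      qed
      show "{s. s + ?c \<in> W \<inter> {a + ?c..<a + ?c + L}} \<in> sets lborel" by measurable
    qed
    finally show ?thesis by (simp add: add.assoc)
  qed
  \<comment> \<open>Moving the window from \<open>a\<close> to \<open>b\<close> changes it only
    inside two intervals of length \<open>\<bar>b - a\<bar>\<close>, one at each end.\<close>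
  have F_lip: "F b L \<le> F a L + 2 * \<bar>b - a\<bar>" if "0 \<le> L" for a b L
  proof -
    let ?J = "\<lambda>x. {min a b + x..<max a b + x}"
    have J: "?J x \<in> fmeasurable lborel" for x
      by (auto intro!: fmeasurableI)
    have "F b L \<le> measure lborel ((W \<inter> {a..<a + L}) \<union> (?J 0 \<union> ?J L))"
      unfolding F_def by (intro measure_mono_fmeasurable fmeasurable.Un fm J) auto
    also have "\<dots> \<le> F a L + measure lborel (?J 0 \<union> ?J L)"
      unfolding F_def by (intro measure_Un_le) auto
    also have "measure lborel (?J 0 \<union> ?J L) \<le> measure lborel (?J 0) + measure lborel (?J L)"
      by (intro measure_Un_le) auto
    also have "\<dots> = 2 * \<bar>b - a\<bar>" by (simp add: max_def min_def)
    finally show ?thesis by simp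
  qed
  have F_le: "F b L \<le> F a L" if L: "0 \<le> L" for a b L
  proof (rule field_le_epsilon)
    fix e :: real assume "0 < e"
    \<comment> \<open>A positive multiplier \<open>k\<close> is essential, since
      \<open>F_orbit\<close> compares windows in the forward direction only.\<close>
    then obtain h k where k: "k > (0::int)" "\<bar>of_int k * \<theta> - of_int h - (b - a)\<bar> < e / 2"
      using sequence_of_fractional_parts_is_dense[OF irr, of "e / 2" "b - a"] half_gt_zero by metis
    define c where "c = a + real (nat k) * \<theta> + of_int (- h)"
    have "F b L \<le> F c L + 2 * \<bar>b - c\<bar>" by (rule F_lip[OF L])
    also have "F c L \<le> F a L" unfolding c_def by (rule F_orbit)
    also have "b - c = - (of_int k * \<theta> - of_int h - (b - a))" using k(1) by (simp add: c_def)
    also have "2 * \<bar>- (of_int k * \<theta> - of_int h - (b - a))\<bar> \<le> e"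
      using k(2) by (simp only: abs_minus_cancel) simp
    finally show "F b L \<le> F a L + e" by simp
  qed
  define G where "G L = F 0 L" for L
  have FG: "F a L = G L" if "0 \<le> L" for a L
    using F_le[OF that, of a 0] F_le[OF that, of 0 a] by (simp add: G_def)
  have G_add: "G (L + L') = G L + G L'" if "0 \<le> L" "0 \<le> L'" for L L'
  proof -
    have "W \<inter> {0..<0 + (L + L')} = (W \<inter> {0..<0 + L}) \<union> (W \<inter> {L..<L + L'})"
      using that by auto
    then have "G (L + L') = measure lborel ((W \<inter> {0..<0 + L}) \<union> (W \<inter> {L..<L + L'}))"
      by (simp add: G_def F_def)
    also have "\<dots> = F 0 L + F L L'"
      unfolding F_def by (intro measure_Un_AE fmeasurableD fm) (use fm in auto)
    finally show ?thesis using FG[OF that(1), of 0] FG[OF that(2), of L] by linarith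
  qed
  have G_nat: "G (real n * L) = real n * G L" if "0 \<le> L" for n L
  proof (induction n)
    case 0
    show ?case by (simp add: G_def F_def)
  next
    case (Suc n)
    then show ?case using G_add[of "real n * L" L] that by (simp add: algebra_simps)
  qed
  have G_nonneg: "0 \<le> G L" for L by (simp add: G_def F_def)
  have G_mono: "G L \<le> G L'" if "0 \<le> L" "L \<le> L'" for L L'
    using G_add[of L "L' - L"] that G_nonneg[of "L' - L"] by simp
  define c where "c = G 1"
  \<comment> \<open>A monotone additive function is linear: rounding \<open>n * L\<close> down and
    up to integers places \<open>n * G L\<close> within \<open>c\<close> of
    \<open>n * L * c\<close>, for every \<open>n\<close>.\<close>
  have G_lin: "G L = c * L" if L: "0 \<le> L" for L
  proof -
    have bound: "real n * \<bar>G L - c * L\<bar> \<le> c" for n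
    proof -
      define m where "m = nat \<lfloor>real n * L\<rfloor>"
      have "0 \<le> real n * L" using L by simp
      then have m: "real m \<le> real n * L" "real n * L \<le> real (Suc m)"
        unfolding m_def by linarith+
      have "real m * c \<le> real n * G L" "real n * G L \<le> real (Suc m) * c"
        using G_mono[OF _ m(1)] G_mono[OF _ m(2)] G_nat[of 1 m] G_nat[of 1 "Suc m"] G_nat[OF L, of n] L
        by (auto simp: c_def)
      moreover have "real m * c \<le> real n * L * c" "real n * L * c \<le> real (Suc m) * c"
        using m G_nonneg[of 1] by (auto simp: c_def intro!: mult_right_mono)
      ultimately have "\<bar>real n * G L - real n * L * c\<bar> \<le> c" by (simp add: algebra_simps abs_le_iff)
      also have "real n * G L - real n * L * c = real n * (G L - c * L)" by (simp add: algebra_simps)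
      finally show ?thesis by (simp add: abs_mult)
    qed
    have "\<not> 0 < \<bar>G L - c * L\<bar>"
    proof
      assume "0 < \<bar>G L - c * L\<bar>"
      then obtain n where "c < real n * \<bar>G L - c * L\<bar>" using reals_Archimedean3 by blast
      then show False using bound[of n] by simp
    qed
    then show ?thesis by simp
  qed
  have em: "emeasure lborel (W \<inter> {a..<b}) = ennreal (c * (b - a))" if "a \<le> b" for a b
    using FG[of "b - a" a] G_lin[of "b - a"] that fm[of a b]
    by (simp add: F_def emeasure_eq_measure2)
  have c0: "0 < c"
  proof (rule ccontr)
    assume "\<not> 0 < c"
    then have "c = 0" using G_nonneg[of 1] by (simp add: c_def)
    then have null: "W \<inter> {- real n..<real n} \<in> null_sets lborel" for n
      using em[of "- real n" "real n"] by (intro null_setsI) auto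
    have "W = (\<Union>n. W \<inter> {- real n..<real n})"
    proof (intro set_eqI iffI)
      fix s assume "s \<in> W"
      moreover obtain n where "\<bar>s\<bar> < real n" using reals_Archimedean2 by blast
      ultimately show "s \<in> (\<Union>n. W \<inter> {- real n..<real n})" by (auto intro!: exI[of _ n])
    qed auto
    also have "\<dots> \<in> null_sets lborel" using null by (intro null_sets_UN) auto
    finally show False using pos by auto
  qed
  \<comment> \<open>Lebesgue measure restricted to \<open>W\<close> and rescaled by the density. It
    agrees with \<open>lborel\<close> on open intervals, hence everywhere, yet gives no mass to the
    complement of \<open>W\<close>.\<close>
  define M where "M = density lborel (\<lambda>s. ennreal (1 / c) * indicator W s)"
  have emM: "emeasure M X = ennreal (1 / c) * emeasure lborel (W \<inter> X)" if [measurable]: "X \<in> sets borel" for X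
  proof -
    have "emeasure M X = (\<integral>\<^sup>+ s. ennreal (1 / c) * indicator (W \<inter> X) s \<partial>lborel)"
      unfolding M_def by (subst emeasure_density) (auto intro!: nn_integral_cong split: split_indicator)
    then show ?thesis by (simp add: nn_integral_cmult)
  qed
  have "lborel = M"
  proof (rule lborel_eqI)
    fix l u :: real
    assume "\<And>b. b \<in> Basis \<Longrightarrow> l \<bullet> b \<le> u \<bullet> b"
    then have lu: "l \<le> u" by simp
    have "emeasure lborel (W \<inter> {l<..<u}) = emeasure lborel (W \<inter> {l..<u})"
    proof (rule emeasure_eq_AE)
      show "AE s in lborel. s \<in> W \<inter> {l<..<u} \<longleftrightarrow> s \<in> W \<inter> {l..<u}"
        using AE_lborel_singleton[of l] by eventually_elim auto
    qed auto
    then have "emeasure M (box l u) = ennreal (1 / c) * ennreal (c * (u - l))"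
      using em[OF lu] by (simp add: emM box_real)
    also have "\<dots> = ennreal (u - l)"
      using c0 lu by (simp flip: ennreal_mult)
    finally show "emeasure M (box l u) = (\<Prod>b\<in>Basis. (u - l) \<bullet> b)" by simp
  qed (simp add: M_def)
  then have "emeasure lborel (- W) = emeasure M (- W)" by simp
  also have "\<dots> = 0" by (subst emM) auto
  finally have "- W \<in> null_sets lborel" by (intro null_setsI) auto
  then show ?thesis by (rule AE_I') auto
qed


section \<open>A second moment bound\<close>

text \<open>The Chung-Erdos inequality, that is Cauchy-Schwarz for the counting function
  \<open>X\<close>. It follows by integrating \<open>2 * c * X \<le> X\<^sup>2 + c\<^sup>2\<close>
  over the union and optimising in \<open>c\<close>.\<close>

lemma measure_UN_ge_second_moment:
  assumes fin: "finite I" and E: "\<And>i. i \<in> I \<Longrightarrow> E i \<in> fmeasurable M"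
  shows "(\<Sum>i\<in>I. measure M (E i))\<^sup>2
    \<le> measure M (\<Union>i\<in>I. E i) * (\<Sum>i\<in>I. \<Sum>j\<in>I. measure M (E i \<inter> E j))"
proof -
  define U where "U = (\<Union>i\<in>I. E i)"
  define S where "S = (\<Sum>i\<in>I. measure M (E i))"
  define Q where "Q = (\<Sum>i\<in>I. \<Sum>j\<in>I. measure M (E i \<inter> E j))"
  define X where "X s = (\<Sum>i\<in>I. indicat_real (E i) s)" for s
  have U: "U \<in> fmeasurable M" unfolding U_def using fin E by (intro fmeasurable.finite_UN) auto
  have ind: "integrable M (indicat_real A)" "(\<integral>s. indicat_real A s \<partial>M) = measure M A"
    if "A \<in> fmeasurable M" for A
    using that by (auto simp: fmeasurable_def)
  have intX: "integrable M X" "(\<integral>s. X s \<partial>M) = S"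
    unfolding X_def S_def using E by (auto simp: ind)
  have X2: "(X s)\<^sup>2 = (\<Sum>i\<in>I. \<Sum>j\<in>I. indicat_real (E i \<inter> E j) s)" for s
    unfolding X_def power2_eq_square sum_product by (simp add: indicator_inter_arith)
  have int2: "integrable M (\<lambda>s. (X s)\<^sup>2)" "(\<integral>s. (X s)\<^sup>2 \<partial>M) = Q"
    unfolding X2 Q_def using E by (auto simp: ind fmeasurable.Int)
  have key: "2 * c * S \<le> Q + c\<^sup>2 * measure M U" for c :: real
  proof -
    have "2 * c * S = (\<integral>s. 2 * c * X s \<partial>M)" using intX by simp
    also have "\<dots> \<le> (\<integral>s. (X s)\<^sup>2 + c\<^sup>2 * indicat_real U s \<partial>M)"
    proof (rule integral_mono)
      fix s
      show "2 * c * X s \<le> (X s)\<^sup>2 + c\<^sup>2 * indicat_real U s"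
      proof (cases "s \<in> U")
        case True
        then show ?thesis using zero_le_power2[of "X s - c"] by (simp add: power2_diff mult_ac)
      next
        case False
        then have "X s = 0" unfolding X_def U_def by (intro sum.neutral) auto
        then show ?thesis using False by simp
      qed
    qed (use intX int2 ind(1)[OF U] in auto)
    also have "\<dots> = Q + c\<^sup>2 * measure M U"
      using int2 ind[OF U] by simp
    finally show ?thesis .
  qed
  have "S\<^sup>2 \<le> measure M U * Q"
  proof (cases "measure M U = 0")
    case True
    have "measure M (E i) = 0" if "i \<in> I" for i
      using measure_mono_fmeasurable[OF _ _ U, of "E i"] E[OF that] that True
      by (auto simp: U_def measure_le_0_iff)
    then show ?thesis using True by (simp add: S_def)
  next
    case False
    then have u: "0 < measure M U" by (simp add: zero_less_measure_iff)
    \<comment> \<open>The value of \<open>c\<close> that makes \<open>key\<close> sharpest.\<close>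
    have "2 * (S / measure M U) * S \<le> Q + (S / measure M U)\<^sup>2 * measure M U" by (rule key)
    then have "S\<^sup>2 / measure M U \<le> Q" using u by (simp add: field_simps power2_eq_square)
    then show ?thesis using u by (simp add: field_simps)
  qed
  then show ?thesis by (simp add: S_def Q_def U_def)
qed

section \<open>Arcs of the circle, realised in the unit interval\<close>

definition arc :: "real \<Rightarrow> real \<Rightarrow> real set" where
  "arc x r = {s \<in> {0..1}. dist_int (x - s) < r}"

lemma arc_measurable [measurable]: "arc x r \<in> sets borel"
  unfolding arc_def by measurable

lemma subset_01_fmeasurable:
  assumes "X \<in> sets borel" "X \<subseteq> {0..1::real}"
  shows "X \<in> fmeasurable lborel"
proof (rule fmeasurableI2[of "{0..1}"])
  show "{0..1::real} \<in> fmeasurable lborel" by (auto intro!: fmeasurableI)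
qed (use assms in auto)

lemma arc_fmeasurable: "arc x r \<in> fmeasurable lborel"
  by (rule subset_01_fmeasurable) (auto simp: arc_def[of x r])

lemma arc_frac: "arc x r = arc (frac x) r"
proof -
  have "dist_int (x - s) = dist_int (frac x - s)" for s
    using dist_int_add_int[of "frac x - s" "\<lfloor>x\<rfloor>"] by (simp add: frac_def)
  then show ?thesis by (simp add: arc_def)
qed

text \<open>Half of the arc suffices: the half on the side of the farther endpoint stays inside
  \<open>{0..1}\<close>, as \<open>r \<le> 1 / 2\<close>.\<close>

lemma measure_arc_ge:
  assumes "0 < r" "r \<le> 1 / 2"
  shows "r \<le> measure lborel (arc x r)"
proof -
  define y where "y = frac x"
  have y: "0 \<le> y" "y < 1" by (auto simp: y_def frac_lt_1)
  have near: "dist_int (y - s) < r" if "\<bar>y - s\<bar> < r" for s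
    using dist_int_le[of "y - s" 0] that by simp
  have "\<exists>a. {a<..<a + r} \<subseteq> arc y r"
  proof (cases "y \<le> 1 / 2")
    case True
    then show ?thesis using near y assms by (intro exI[of _ y]) (auto simp: arc_def)
  next
    case False
    then show ?thesis using near y assms by (intro exI[of _ "y - r"]) (auto simp: arc_def)
  qed
  then obtain a where "{a<..<a + r} \<subseteq> arc y r" by blast
  then have "measure lborel {a<..<a + r} \<le> measure lborel (arc y r)"
    by (intro measure_mono_fmeasurable arc_fmeasurable) auto
  then show ?thesis using assms by (simp add: y_def flip: arc_frac)
qed

text \<open>With the centre reduced to the unit interval, only the integer translates by -1, 0 and 1
  can meet \<open>{0..1}\<close>; each contributes length \<open>2 * r\<close>.\<close>

lemma measure_arc_le:
  assumes "0 < r"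
  shows "measure lborel (arc x r) \<le> 6 * r"
proof -
  define y where "y = frac x"
  have y: "0 \<le> y" "y < 1" by (auto simp: y_def frac_lt_1)
  let ?J = "\<lambda>m. {y + m - r..y + m + r}"
  have J: "?J m \<in> fmeasurable lborel" for m :: real
    by (auto intro!: fmeasurableI simp: emeasure_lborel_Icc_eq)
  have mJ: "measure lborel (?J m) = 2 * r" for m using assms by simp
  have "arc y r \<subseteq> ?J (- 1) \<union> (?J 0 \<union> ?J 1)"
  proof
    fix s assume s: "s \<in> arc y r"
    then have s': "0 \<le> s" "s \<le> 1" "\<bar>y - s - of_int (round (y - s))\<bar> < r"
      by (auto simp: arc_def dist_int_def)
    have "-1 \<le> round (y - s)" "round (y - s) \<le> 1"
      using s' y unfolding round_def by linarith+
    then have "round (y - s) \<in> {-1, 0, 1}" by auto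
    then show "s \<in> ?J (- 1) \<union> (?J 0 \<union> ?J 1)" using s' by auto
  qed
  then have "measure lborel (arc y r) \<le> measure lborel (?J (- 1) \<union> (?J 0 \<union> ?J 1))"
    by (intro measure_mono_fmeasurable fmeasurable.Un J) auto
  also have "\<dots> \<le> measure lborel (?J (- 1)) + measure lborel (?J 0 \<union> ?J 1)"
    by (rule measure_Un_le) auto
  also have "measure lborel (?J 0 \<union> ?J 1) \<le> measure lborel (?J 0) + measure lborel (?J 1)"
    by (rule measure_Un_le) auto
  finally have "measure lborel (arc y r) \<le> 6 * r" unfolding mJ by simp
  then show ?thesis by (simp add: y_def flip: arc_frac)
qed

text \<open>Arcs that meet have centres closer than \<open>r + r' \<le> 2 * r'\<close>; in that case
  the whole smaller arc serves as an upper bound.\<close>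

lemma measure_arc_Int_le:
  assumes "0 < r" "r \<le> r'"
  shows "measure lborel (arc x r \<inter> arc y r') \<le> (if dist_int (x - y) < 2 * r' then 6 * r else 0)"
proof (cases "dist_int (x - y) < 2 * r'")
  case True
  have "measure lborel (arc x r \<inter> arc y r') \<le> measure lborel (arc x r)"
    by (intro measure_mono_fmeasurable arc_fmeasurable) auto
  then show ?thesis using True measure_arc_le[OF assms(1), of x] by simp
next
  case False
  have "arc x r \<inter> arc y r' = {}"
  proof (rule ccontr)
    assume "arc x r \<inter> arc y r' \<noteq> {}"
    then obtain s where "dist_int (x - s) < r" "dist_int (y - s) < r'" by (auto simp: arc_def)
    then show False
      using dist_int_diff_le[of "x - s" "y - s"] False assms by simp
  qed
  then show ?thesis using False by simp
qed

lemma sum_symmetric_le: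
  fixes h :: "'a::linorder \<Rightarrow> 'a \<Rightarrow> real"
  assumes fin: "finite I" and sym: "\<And>s t. h s t = h t s" and nonneg: "\<And>s t. 0 \<le> h s t"
  shows "(\<Sum>t\<in>I. \<Sum>s\<in>I. h t s) \<le> 2 * (\<Sum>t\<in>I. \<Sum>s | s \<in> I \<and> s \<le> t. h t s)"
proof -
  let ?g = "\<lambda>t s. if s \<le> t then h t s else 0"
  have "(\<Sum>t\<in>I. \<Sum>s\<in>I. h t s) \<le> (\<Sum>t\<in>I. \<Sum>s\<in>I. ?g t s + ?g s t)"
    using nonneg sym by (intro sum_mono) (auto simp: not_le)
  also have "\<dots> = (\<Sum>t\<in>I. \<Sum>s\<in>I. ?g t s) + (\<Sum>t\<in>I. \<Sum>s\<in>I. ?g s t)"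
    by (simp add: sum.distrib)
  also have "(\<Sum>t\<in>I. \<Sum>s\<in>I. ?g s t) = (\<Sum>t\<in>I. \<Sum>s\<in>I. ?g t s)" by (rule sum.swap)
  finally show ?thesis
    using fin by (simp add: sum.inter_filter flip: sum.inter_filter)
qed

text \<open>Over a finite stretch of scales the arcs have total measure at least \<open>V\<close>,
  the sum of \<open>N t * r t\<close>, while their pair correlations sum to at most
  \<open>12 * (A + K) * V\<^sup>2\<close>. The second moment bound then leaves a constant that does
  not depend on \<open>T\<close>.\<close>

lemma measure_hits_ge:
  fixes N :: "nat \<Rightarrow> nat" and r :: "nat \<Rightarrow> real" and B :: "nat \<Rightarrow> nat \<Rightarrow> real"
  assumes r: "\<And>t. 0 < r t" "\<And>t. r t \<le> 1 / 2" "\<And>s t. s \<le> t \<Longrightarrow> r t \<le> r s"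
    and count: "\<And>s t x. s \<le> t \<Longrightarrow>
      real (card {n \<in> {N t..<N t + N t}. dist_int (real n * \<theta> - x) < 2 * r s}) \<le> A * r s * real (N t) + B s t"
    and B: "\<And>s t. 0 \<le> B s t" "\<And>t. (\<Sum>s\<le>t. real (N s) * B s t) \<le> K * real (N t)"
    and AK: "0 < A" "0 \<le> K"
    and div: "\<not> summable (\<lambda>t. real (N t) * r t)"
  shows "1 / (12 * (A + K))
    \<le> measure lborel {s \<in> {0..1}. \<exists>t\<ge>T. \<exists>n\<in>{N t..<N t + N t}. dist_int (real n * \<theta> - s) < r t}"
    (is "_ \<le> measure lborel ?H")
proof -
  let ?R = "\<lambda>t. {N t..<N t + N t}"
  \<comment> \<open>Divergence provides a stretch with \<open>V \<ge> 1\<close>, so that error terms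
    linear in \<open>V\<close> can later be absorbed into \<open>V\<^sup>2\<close>.\<close>
  obtain T' where V1: "1 \<le> (\<Sum>t\<in>{T..<T'}. real (N t) * r t)"
  proof -
    have "\<not> summable (\<lambda>t. real (N (t + T)) * r (t + T))"
      using div by (simp only: summable_iff_shift[where f = "\<lambda>t. real (N t) * r t"]) simp
    then obtain n where "1 < (\<Sum>t<n. real (N (t + T)) * r (t + T))"
      using summableI_nonneg_bounded[of "\<lambda>t. real (N (t + T)) * r (t + T)" 1] r(1)
      by (metis less_imp_le mult_nonneg_nonneg not_le of_nat_0_le_iff)
    also have "(\<Sum>t<n. real (N (t + T)) * r (t + T)) = (\<Sum>t\<in>{T..<n + T}. real (N t) * r t)"
      using sum.shift_bounds_nat_ivl[of "\<lambda>t. real (N t) * r t" 0 T n]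
      by (simp add: lessThan_atLeast0)
    finally show ?thesis using that[of "n + T"] by linarith
  qed
  define J where "J = {T..<T'}"
  define V where "V = (\<Sum>t\<in>J. real (N t) * r t)"
  define I where "I = Sigma J ?R"
  define E where "E = (\<lambda>(t, n). arc (real n * \<theta>) (r t))"
  define S where "S = (\<Sum>i\<in>I. measure lborel (E i))"
  define Q where "Q = (\<Sum>i\<in>I. \<Sum>j\<in>I. measure lborel (E i \<inter> E j))"
  have finJ: "finite J" by (simp add: J_def)
  have finI: "finite I" by (simp add: I_def J_def)
  have V: "1 \<le> V" using V1 by (simp add: V_def J_def)
  have SV: "V \<le> S"
  proof -
    have "V = (\<Sum>t\<in>J. \<Sum>n\<in>?R t. r t)" by (simp add: V_def)
    also have "\<dots> \<le> (\<Sum>t\<in>J. \<Sum>n\<in>?R t. measure lborel (arc (real n * \<theta>) (r t)))"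
      using r by (intro sum_mono measure_arc_ge) auto
    also have "\<dots> = S" by (simp add: S_def I_def E_def J_def sum.Sigma split_beta)
    finally show ?thesis .
  qed
  define h where "h t s = (\<Sum>n\<in>?R t. \<Sum>m\<in>?R s.
    measure lborel (arc (real n * \<theta>) (r t) \<inter> arc (real m * \<theta>) (r s)))" for t s
  have h_sym: "h t s = h s t" for s t
    unfolding h_def by (subst sum.swap) (simp add: Int_commute)
  have h_nonneg: "0 \<le> h t s" for s t unfolding h_def by (intro sum_nonneg) auto
  have sumI: "(\<Sum>i\<in>I. f i) = (\<Sum>t\<in>J. \<Sum>n\<in>?R t. f (t, n))" for f :: "nat \<times> nat \<Rightarrow> real"
    by (simp add: I_def J_def sum.Sigma split_beta)
  have "Q = (\<Sum>t\<in>J. \<Sum>n\<in>?R t. \<Sum>s\<in>J. \<Sum>m\<in>?R s.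
      measure lborel (arc (real n * \<theta>) (r t) \<inter> arc (real m * \<theta>) (r s)))"
    unfolding Q_def sumI by (simp add: E_def)
  also have "\<dots> = (\<Sum>t\<in>J. \<Sum>s\<in>J. h t s)"
    unfolding h_def by (rule sum.cong[OF refl], rule sum.swap)
  also have "\<dots> \<le> 2 * (\<Sum>t\<in>J. \<Sum>s | s \<in> J \<and> s \<le> t. h t s)"
    by (rule sum_symmetric_le[OF finJ h_sym h_nonneg])
  also have "(\<Sum>t\<in>J. \<Sum>s | s \<in> J \<and> s \<le> t. h t s) \<le> (\<Sum>t\<in>J. 6 * (real (N t) * r t) * (A * V + K))"
  proof (rule sum_mono)
    fix t assume "t \<in> J"
    let ?D = "{s \<in> J. s \<le> t}"
    \<comment> \<open>As \<open>s \<le> t\<close>, the arcs of scale \<open>t\<close> are the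
      smaller ones. They supply the measure, and the larger radius \<open>r s\<close> decides which
      centres are close; for fixed \<open>m\<close> the hypothesis \<open>count\<close> bounds the
      number of such \<open>n\<close>.\<close>
    have h_le: "h t s \<le> 6 * r t * real (N s) * (A * r s * real (N t) + B s t)" if s: "s \<le> t" for s
    proof -
      have "h t s \<le> (\<Sum>n\<in>?R t. \<Sum>m\<in>?R s. if dist_int (real n * \<theta> - real m * \<theta>) < 2 * r s then 6 * r t else 0)"
        unfolding h_def using r s by (intro sum_mono measure_arc_Int_le) auto
      also have "\<dots> = (\<Sum>m\<in>?R s. \<Sum>n\<in>?R t. if dist_int (real n * \<theta> - real m * \<theta>) < 2 * r s then 6 * r t else 0)"
        by (rule sum.swap)
      also have "\<dots> = (\<Sum>m\<in>?R s. 6 * r t * real (card {n \<in> ?R t. dist_int (real n * \<theta> - real m * \<theta>) < 2 * r s}))"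
        by (intro sum.cong refl) (simp flip: sum.inter_filter)
      also have "\<dots> \<le> (\<Sum>m\<in>?R s. 6 * r t * (A * r s * real (N t) + B s t))"
        using r(1)[of t] by (intro sum_mono mult_left_mono count[OF s]) auto
      finally show ?thesis by (simp add: algebra_simps)
    qed
    have "(\<Sum>s\<in>?D. h t s) \<le> (\<Sum>s\<in>?D. 6 * r t * real (N s) * (A * r s * real (N t) + B s t))"
      by (intro sum_mono h_le) auto
    also have "\<dots> = 6 * r t * (A * real (N t) * (\<Sum>s\<in>?D. real (N s) * r s) + (\<Sum>s\<in>?D. real (N s) * B s t))"
      by (simp add: sum_distrib_left sum.distrib algebra_simps)
    also have "\<dots> \<le> 6 * r t * (A * real (N t) * V + K * real (N t))"
    proof (intro mult_left_mono add_mono)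
      show "(\<Sum>s\<in>?D. real (N s) * r s) \<le> V"
        unfolding V_def using finJ r(1) by (intro sum_mono2) (auto simp: less_imp_le)
      have "(\<Sum>s\<in>?D. real (N s) * B s t) \<le> (\<Sum>s\<le>t. real (N s) * B s t)"
        using B(1) by (intro sum_mono2) auto
      then show "(\<Sum>s\<in>?D. real (N s) * B s t) \<le> K * real (N t)" using B(2)[of t] by linarith
    qed (use AK r(1)[of t] in auto)
    finally show "(\<Sum>s\<in>?D. h t s) \<le> 6 * (real (N t) * r t) * (A * V + K)" by (simp add: algebra_simps)
  qed
  also have "(\<Sum>t\<in>J. 6 * (real (N t) * r t) * (A * V + K)) = 6 * V * (A * V + K)"
    by (simp add: V_def flip: sum_distrib_left sum_distrib_right)
  finally have "Q \<le> 12 * V * (A * V + K)" by simp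
  also have "\<dots> \<le> 12 * V * (A * V + K * V)"
    using V AK mult_left_mono[of 1 V K] by (intro mult_left_mono add_mono) auto
  finally have Q: "Q \<le> 12 * (A + K) * V\<^sup>2" by (simp add: algebra_simps power2_eq_square)
  define u where "u = measure lborel (\<Union>i\<in>I. E i)"
  have "V\<^sup>2 \<le> S\<^sup>2" using SV V by (intro power_mono) auto
  also have "\<dots> \<le> u * Q"
    unfolding S_def Q_def u_def
    by (rule measure_UN_ge_second_moment[OF finI]) (auto simp: E_def arc_fmeasurable)
  also have "\<dots> \<le> u * (12 * (A + K) * V\<^sup>2)" by (intro mult_left_mono Q) (simp add: u_def)
  finally have "1 \<le> u * (12 * (A + K))" using V by (simp add: mult.assoc)
  then have "1 / (12 * (A + K)) \<le> u" using AK by (simp add: field_simps)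
  also have "u \<le> measure lborel ?H"
    unfolding u_def
  proof (rule measure_mono_fmeasurable)
    show "(\<Union>i\<in>I. E i) \<subseteq> ?H" by (fastforce simp: I_def E_def J_def arc_def)
    show "(\<Union>i\<in>I. E i) \<in> sets lborel" using finI by (intro sets.finite_UN) (auto simp: E_def)
    show "?H \<in> fmeasurable lborel" by (rule subset_01_fmeasurable) (measurable, auto)
  qed
  finally show ?thesis .
qed


section \<open>Divergence of condensed series\<close>

text \<open>Cauchy condensation with base \<open>M\<close>: the block from \<open>M ^ k\<close> to
  \<open>M ^ Suc k\<close> has fewer than \<open>M ^ Suc k\<close> terms, each at most its first
  one.\<close>

lemma not_summable_geometric_subsequence:
  fixes \<phi> :: "nat \<Rightarrow> real"
  assumes mono: "mono_on {1..} \<phi>" and pos: "\<And>n. 1 \<le> n \<Longrightarrow> 0 < \<phi> n"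
    and div: "\<not> summable (\<lambda>n. 1 / (real (Suc n) * \<phi> (Suc n)))" and M: "2 \<le> M"
  shows "\<not> summable (\<lambda>k. 1 / \<phi> (M ^ k))"
proof
  assume sm: "summable (\<lambda>k. 1 / \<phi> (M ^ k))"
  let ?g = "\<lambda>n. 1 / (real n * \<phi> n)"
  have Mk: "1 \<le> M ^ k" for k using M by simp
  have block: "sum ?g {1..<M ^ k} \<le> real M * (\<Sum>j<k. 1 / \<phi> (M ^ j))" for k
  proof (induction k)
    case (Suc k)
    have le: "M ^ k \<le> M ^ Suc k" using M by simp
    have "sum ?g {M ^ k..<M ^ Suc k} \<le> (\<Sum>n\<in>{M ^ k..<M ^ Suc k}. ?g (M ^ k))"
    proof (rule sum_mono)
      fix n assume n: "n \<in> {M ^ k..<M ^ Suc k}"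
      then have "1 \<le> n" using Mk[of k] by simp
      have "real (M ^ k) * \<phi> (M ^ k) \<le> real n * \<phi> n"
        using n Mk[of k] pos[OF Mk[of k]] by (intro mult_mono mono_onD[OF mono]) auto
      then show "?g n \<le> ?g (M ^ k)"
        using Mk[of k] pos[OF Mk[of k]] by (intro divide_left_mono mult_pos_pos pos) (use \<open>1 \<le> n\<close> M in auto)
    qed
    also have "\<dots> = real (M ^ Suc k - M ^ k) * ?g (M ^ k)" by simp
    also have "\<dots> \<le> real (M ^ Suc k) * ?g (M ^ k)"
      using pos[OF Mk[of k]] by (intro mult_right_mono of_nat_mono diff_le_self) auto
    also have "\<dots> = real M * (1 / \<phi> (M ^ k))" using M by simp
    finally have "sum ?g {M ^ k..<M ^ Suc k} \<le> real M * (1 / \<phi> (M ^ k))" .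
    moreover have "sum ?g {1..<M ^ Suc k} = sum ?g {1..<M ^ k} + sum ?g {M ^ k..<M ^ Suc k}"
      using sum.atLeastLessThan_concat[OF Mk le, of ?g] by simp
    ultimately show ?case using Suc.IH by (simp add: algebra_simps)
  qed simp
  have "summable (\<lambda>n. 1 / (real (Suc n) * \<phi> (Suc n)))"
  proof (rule summableI_nonneg_bounded)
    fix n
    show "0 \<le> 1 / (real (Suc n) * \<phi> (Suc n))" using pos[of "Suc n"] by simp
    have "Suc n \<le> 2 ^ n" by (metis Suc_leI less_exp)
    also have "(2::nat) ^ n \<le> M ^ n" using M by (intro power_mono) auto
    finally have n: "Suc n \<le> M ^ n" .
    have "(\<Sum>i<n. 1 / (real (Suc i) * \<phi> (Suc i))) = sum ?g {1..<Suc n}"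
      using sum.shift_bounds_Suc_ivl[of ?g 0 n] by (simp add: lessThan_atLeast0)
    also have "\<dots> \<le> sum ?g {1..<M ^ n}"
      using n pos by (intro sum_mono2) (auto simp: less_imp_le)
    also have "\<dots> \<le> real M * (\<Sum>j<n. 1 / \<phi> (M ^ j))" by (rule block)
    also have "\<dots> \<le> real M * (\<Sum>j. 1 / \<phi> (M ^ j))"
      using pos[OF Mk] by (intro mult_left_mono sum_le_suminf sm) (auto simp: less_imp_le)
    finally show "(\<Sum>i<n. 1 / (real (Suc i) * \<phi> (Suc i))) \<le> real M * (\<Sum>j. 1 / \<phi> (M ^ j))" .
  qed
  then show False using div by contradiction
qed

text \<open>A summable monotone sequence is \<open>o(1/k)\<close>, so eventually the maximum is \<open>g k\<close>.\<close>

lemma not_summable_max_linear: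
  fixes g :: "nat \<Rightarrow> real"
  assumes mono: "mono g" and pos: "\<And>k. 0 < g k" and c: "0 < c"
    and div: "\<not> summable (\<lambda>k. 1 / g k)"
  shows "\<not> summable (\<lambda>k. 1 / max (g k) (c * real k))"
proof
  define h where "h k = 1 / max (g k) (c * real k)" for k
  assume "summable (\<lambda>k. 1 / max (g k) (c * real k))"
  then have "summable h" by (simp add: h_def[abs_def])
  then obtain n0 where n0: "\<And>m n. m \<ge> n0 \<Longrightarrow> norm (sum h {m..<n}) < 1 / (2 * c)"
    using c unfolding summable_Cauchy by (meson divide_pos_pos mult_pos_pos zero_less_numeral zero_less_one)
  have mpos: "0 < max (g k) (c * real k)" for k using pos[of k] by (simp add: less_max_iff_disj)
  have h_anti: "h n \<le> h m" if "m \<le> n" for m n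
  proof -
    have "max (g m) (c * real m) \<le> max (g n) (c * real n)"
      using that monoD[OF mono that] c by (intro max.mono) auto
    then show ?thesis
      unfolding h_def using mpos by (intro divide_left_mono mult_pos_pos) auto
  qed
  \<comment> \<open>For such \<open>n\<close> at least half of the indices below \<open>n\<close>
    lie in the Cauchy tail. As \<open>h\<close> decreases, the tail bound \<open>1 / (2 * c)\<close>
    yields \<open>h n < 1 / (c * n)\<close>, which excludes \<open>c * n\<close> as the
    maximum.\<close>
  have "h n = 1 / g n" if n: "n \<ge> 2 * n0 + 1" for n
  proof -
    have "real n / 2 * h n \<le> real (n - n0) * h n"
      using n mpos[of n] by (intro mult_right_mono) (auto simp: h_def less_imp_le)
    also have "\<dots> = (\<Sum>k\<in>{n0..<n}. h n)" by simp
    also have "\<dots> \<le> sum h {n0..<n}" by (intro sum_mono h_anti) auto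
    also have "\<dots> < 1 / (2 * c)" using n0[of n0 n] by (simp add: abs_less_iff)
    finally have "c * real n < max (g n) (c * real n)"
      using c mpos[of n] by (simp add: h_def field_simps)
    then have "max (g n) (c * real n) = g n" by linarith
    then show ?thesis by (simp add: h_def)
  qed
  then have "\<forall>\<^sub>F n in sequentially. h n = 1 / g n"
    unfolding eventually_sequentially by blast
  then have "summable (\<lambda>k. 1 / g k)" using \<open>summable h\<close> by (rule summable_cong[THEN iffD1])
  then show False using div by contradiction
qed

section \<open>From positive measure to almost everywhere\<close>

text \<open>A lower bound on the hit sets that is uniform in \<open>n0\<close> survives the
  decreasing intersection, so \<open>W\<close> is not null and the zero-one law makes it conull.
  Countably many \<open>\<epsilon>\<close> tending to 0 then suffice.\<close>

lemma AE_liminf_eq_0: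
  fixes \<phi> :: "nat \<Rightarrow> real"
  assumes irr: "\<theta> \<notin> \<rat>"
    and mono: "mono_on {1..} \<phi>" and pos: "\<And>n. 1 \<le> n \<Longrightarrow> 0 < \<phi> n" and \<delta>: "0 < \<delta>"
    and hits: "\<And>\<epsilon>. 0 < \<epsilon> \<Longrightarrow> \<epsilon> \<le> \<delta> \<Longrightarrow> \<exists>c>0. \<forall>n0. c \<le> measure lborel
      {s \<in> {0..1}. \<exists>n\<ge>n0. 1 \<le> n \<and> real n * \<phi> n * dist_int (real n * \<theta> - s) < \<epsilon>}"
  shows "AE s in lebesgue. liminf (\<lambda>n. ereal (real n * \<phi> n * dist_int (real n * \<theta> - s))) = 0"
proof -
  define f where "f n s = real n * \<phi> n * dist_int (real n * \<theta> - s)" for n s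
  have [measurable]: "f n \<in> borel_measurable borel" for n
    unfolding f_def by measurable
  define W where "W \<epsilon> = {s. \<forall>n0. \<exists>n\<ge>n0. 1 \<le> n \<and> f n s < \<epsilon>}" for \<epsilon>
  have AE_W: "AE s in lborel. s \<in> W \<epsilon>" if \<epsilon>: "0 < \<epsilon>" "\<epsilon> \<le> \<delta>" for \<epsilon>
  proof (rule rotation_zero_one[OF irr])
    show "W \<epsilon> \<in> sets borel" unfolding W_def by measurable
  next
    fix s assume s: "s \<in> W \<epsilon>"
    show "s - \<theta> \<in> W \<epsilon>"
      unfolding W_def
    proof (intro CollectI allI)
      fix n0
      \<comment> \<open>Rotating by \<theta> lowers the index by one; \<open>n0 + 2\<close> leaves
        room for the predecessor to stay at least 1, where \<phi> is positive and monotone.\<close>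
      obtain n where n: "n \<ge> n0 + 2" "f n s < \<epsilon>" using s unfolding W_def by blast
      then obtain k where k: "n = Suc k" "1 \<le> k" "n0 \<le> k" by (cases n) auto
      have "real k * \<phi> k \<le> real n * \<phi> n"
        using k pos[of k] by (intro mult_mono mono_onD[OF mono]) auto
      moreover have "real k * \<theta> - (s - \<theta>) = real n * \<theta> - s"
        using k(1) by (simp add: algebra_simps)
      ultimately have "f k (s - \<theta>) \<le> f n s"
        unfolding f_def by (metis dist_int_nonneg mult_right_mono)
      then show "\<exists>n\<ge>n0. 1 \<le> n \<and> f n (s - \<theta>) < \<epsilon>" using n k by (intro exI[of _ k]) auto
    qed
  next
    fix s assume s: "s \<in> W \<epsilon>"
    have "f n (s + 1) = f n s" "f n (s - 1) = f n s" for n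
      using dist_int_add_int[of "real n * \<theta> - s" "-1"] dist_int_add_int[of "real n * \<theta> - s" 1]
      by (simp_all add: f_def algebra_simps)
    then show "s + 1 \<in> W \<epsilon>" "s - 1 \<in> W \<epsilon>" using s by (simp_all add: W_def)
  next
    obtain c where c: "0 < c" "\<And>n0. c \<le> measure lborel {s \<in> {0..1}. \<exists>n\<ge>n0. 1 \<le> n \<and> f n s < \<epsilon>}"
      using hits[OF \<epsilon>] unfolding f_def by blast
    let ?U = "\<lambda>n0. {s \<in> {0..1}. \<exists>n\<ge>n0. 1 \<le> n \<and> f n s < \<epsilon>}"
    have U: "?U n0 \<in> fmeasurable lborel" for n0
      by (rule subset_01_fmeasurable) (measurable, auto)
    have "(\<lambda>n0. measure lborel (?U n0)) \<longlonglongrightarrow> measure lborel (\<Inter>n0. ?U n0)"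
    proof (rule Lim_measure_decseq)
      show "decseq ?U" by (intro decseq_SucI) (blast dest: Suc_leD)
      show "emeasure lborel (?U n0) \<noteq> \<infinity>" for n0
        using fmeasurableD2[OF U[of n0]] by simp
    qed (use U in auto)
    then have "c \<le> measure lborel (\<Inter>n0. ?U n0)"
      using c(2) by (intro LIMSEQ_le_const[of _ _ c]) auto
    also have "(\<Inter>n0. ?U n0) = W \<epsilon> \<inter> {0..1}" unfolding W_def by auto
    finally have pos': "0 < measure lborel (W \<epsilon> \<inter> {0..1})" using c(1) by linarith
    show "emeasure lborel (W \<epsilon>) \<noteq> 0"
    proof
      assume "emeasure lborel (W \<epsilon>) = 0"
      moreover have "emeasure lborel (W \<epsilon> \<inter> {0..1}) \<le> emeasure lborel (W \<epsilon>)"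
        unfolding W_def by (intro emeasure_mono) auto
      ultimately show False using pos' by (simp add: measure_def)
    qed
  qed
  have "AE s in lborel. \<forall>j. s \<in> W (\<delta> / real (Suc j))"
    using \<delta> by (subst AE_all_countable) (auto intro!: AE_W simp: field_simps)
  then have "AE s in lborel. liminf (\<lambda>n. ereal (f n s)) = 0"
  proof eventually_elim
    case (elim s)
    have f_nonneg: "0 \<le> f n s" for n
    proof (cases "n = 0")
      case False
      then show ?thesis using pos[of n] by (simp add: f_def)
    qed (simp add: f_def)
    show ?case
    proof (rule antisym)
      show "0 \<le> liminf (\<lambda>n. ereal (f n s))"
        by (rule Liminf_bounded) (simp add: f_nonneg)
      show "liminf (\<lambda>n. ereal (f n s)) \<le> 0"
      proof (rule ccontr)
        assume "\<not> liminf (\<lambda>n. ereal (f n s)) \<le> 0"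
        then have "0 < liminf (\<lambda>n. ereal (f n s))" by simp
        then obtain e where e: "0 < ereal e" "ereal e < liminf (\<lambda>n. ereal (f n s))"
          using ereal_dense2 by blast
        obtain j where j: "\<delta> / real (Suc j) < e"
        proof -
          obtain n where "\<delta> / e < real n" using reals_Archimedean2 by blast
          then have "\<delta> / real (Suc n) < e" using e(1) \<delta> by (simp add: field_simps)
          then show ?thesis by (rule that)
        qed
        obtain n0 where n0: "\<And>n. n \<ge> n0 \<Longrightarrow> ereal e < ereal (f n s)"
          using less_LiminfD[OF e(2)] unfolding eventually_sequentially by blast
        obtain n where "n \<ge> n0" "f n s < \<delta> / real (Suc j)"
          using elim[rule_format, of j] unfolding W_def by blast
        then show False using n0[of n] j by simp
      qed
    qed
  qed
  then have "AE s in lebesgue. liminf (\<lambda>n. ereal (f n s)) = 0" by (rule AE_completion)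
  then show ?thesis by (simp add: f_def)
qed

text \<open>Within a block \<open>n < 2 * N t\<close>, so monotonicity and the choice of radius turn
  closeness \<open>r t\<close> into the required inequality with \<open>\<epsilon>\<close>. The
  condition \<open>t \<le> N t\<close> ensures that late scales involve only large
  \<open>n\<close>.\<close>

lemma measure_orbit_hits_ge:
  fixes \<phi> r :: "nat \<Rightarrow> real" and N :: "nat \<Rightarrow> nat" and B :: "nat \<Rightarrow> nat \<Rightarrow> real"
  assumes mono: "mono_on {1..} \<phi>" and pos: "\<And>n. 1 \<le> n \<Longrightarrow> 0 < \<phi> n"
    and N: "mono N" "\<And>t. t \<le> N t" "\<And>t. 0 < N t"
    and r: "\<And>t. 0 < r t" "\<And>t. r t \<le> 1 / 2" "\<And>s t. s \<le> t \<Longrightarrow> r t \<le> r s"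
      "\<And>t. real (2 * N t) * \<phi> (2 * N t) * r t \<le> \<epsilon>"
    and count: "\<And>s t x. s \<le> t \<Longrightarrow>
      real (card {n \<in> {N t..<N t + N t}. dist_int (real n * \<theta> - x) < 2 * r s}) \<le> A * r s * real (N t) + B s t"
    and B: "\<And>s t. 0 \<le> B s t" "\<And>t. (\<Sum>s\<le>t. real (N s) * B s t) \<le> K * real (N t)"
    and AK: "0 < A" "0 \<le> K"
    and div: "\<not> summable (\<lambda>t. real (N t) * r t)"
  shows "\<exists>c>0. \<forall>n0. c \<le> measure lborel
      {s \<in> {0..1}. \<exists>n\<ge>n0. 1 \<le> n \<and> real n * \<phi> n * dist_int (real n * \<theta> - s) < \<epsilon>}"
proof (intro exI[of _ "1 / (12 * (A + K))"] conjI allI)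
  show "0 < 1 / (12 * (A + K))" using AK by simp
  fix n0
  let ?U = "{s \<in> {0..1}. \<exists>n\<ge>n0. 1 \<le> n \<and> real n * \<phi> n * dist_int (real n * \<theta> - s) < \<epsilon>}"
  let ?H = "{s \<in> {0..1}. \<exists>t\<ge>n0. \<exists>n\<in>{N t..<N t + N t}. dist_int (real n * \<theta> - s) < r t}"
  have "1 / (12 * (A + K)) \<le> measure lborel ?H"
    by (rule measure_hits_ge[OF r(1-3) count B AK div])
  also have "\<dots> \<le> measure lborel ?U"
  proof (rule measure_mono_fmeasurable)
    show "?H \<subseteq> ?U"
    proof
      fix s assume "s \<in> ?H"
      then obtain t n where s: "s \<in> {0..1}" and t: "t \<ge> n0" "N t \<le> n" "n < N t + N t"
        and d: "dist_int (real n * \<theta> - s) < r t"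
        by auto
      have n: "1 \<le> n" "n0 \<le> n" using t N(2,3)[of t] by auto
      have "real n * \<phi> n * dist_int (real n * \<theta> - s) < real n * \<phi> n * r t"
        using d n pos[OF n(1)] by (intro mult_strict_left_mono) auto
      also have "\<dots> \<le> real (2 * N t) * \<phi> (2 * N t) * r t"
        using n t r(1)[of t] pos[OF n(1)] by (intro mult_right_mono mult_mono mono_onD[OF mono]) auto
      also have "\<dots> \<le> \<epsilon>" by (rule r(4))
      finally show "s \<in> ?U" using s n by blast
    qed
    show "?H \<in> sets lborel" by measurable
    show "?U \<in> fmeasurable lborel" by (rule subset_01_fmeasurable) (measurable, auto)
  qed
  finally show "1 / (12 * (A + K)) \<le> measure lborel ?U" .
qed


section \<open>The two growth conditions\<close>

lemma sum_doubling_le: "(\<Sum>s\<le>t. (2::nat) ^ (s + a)) \<le> 2 * 2 ^ (t + a)"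
  by (induction t) auto

text \<open>Only scales below \<open>m / 2\<close> contribute, and a sum of successive powers of 2
  is less than twice its largest term.\<close>

lemma sum_doubling_below_le:
  "(\<Sum>s\<le>t. if 2 * 2 ^ (s + a) < m then 2 ^ (s + a) else 0) \<le> (m :: nat)"
proof (induction t)
  case 0
  have "2 * x < m \<Longrightarrow> x \<le> m" for x by linarith
  then show ?case unfolding atMost_0 by simp
next
  case (Suc t)
  show ?case
  proof (cases "2 * 2 ^ (Suc t + a) < m")
    case True
    have "(\<Sum>s\<le>Suc t. if 2 * 2 ^ (s + a) < m then 2 ^ (s + a) else 0) \<le> (\<Sum>s\<le>Suc t. (2::nat) ^ (s + a))"
      by (intro sum_mono) auto
    also have "\<dots> \<le> 2 * 2 ^ (Suc t + a)" by (rule sum_doubling_le)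
    finally show ?thesis using True by linarith
  next
    case False
    then show ?thesis using Suc by simp
  qed
qed

context
  fixes \<theta> :: real and \<phi> :: "nat \<Rightarrow> real"
  assumes irr: "\<theta> \<notin> \<rat>" and pos0: "0 < \<theta>" and less1: "\<theta> < 1"
    and mono: "mono_on {1..} \<phi>" and pos: "\<And>n. 1 \<le> n \<Longrightarrow> 0 < \<phi> n"
    and div: "\<not> summable (\<lambda>n. 1 / (real (Suc n) * \<phi> (Suc n)))"
begin

text \<open>A block at scale \<open>q t\<close> has exactly the length that
  \<open>card_window_le\<close> admits, so the error term is just 1. Exponential growth enters only
  through divergence, by comparing \<open>2 * q k\<close> with powers of a fixed
  \<open>M\<close>.\<close>

lemma AE_liminf_exponential_denoms:
  assumes C: "\<And>k. real (cf_denom \<theta> k) \<le> C ^ k"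
  shows "AE s in lebesgue. liminf (\<lambda>n. ereal (real n * \<phi> n * dist_int (real n * \<theta> - s))) = 0"
proof (rule AE_liminf_eq_0[OF irr mono pos])
  \<comment> \<open>This fixes \<open>\<delta>\<close> as \<open>\<phi> 1\<close>: since
    \<open>w t \<ge> 2 * \<phi> 1\<close>, all radii are then at most 1/2.\<close>
  show "0 < \<phi> 1" by (simp add: pos)
  fix \<epsilon> :: real assume \<epsilon>: "0 < \<epsilon>" "\<epsilon> \<le> \<phi> 1"
  define q where "q = cf_denom \<theta>"
  have q: "mono q" "\<And>t. t \<le> q t" "\<And>t. 0 < q t"
    unfolding q_def by (rule mono_cf_denom cf_denom_ge cf_denom_pos; fact irr pos0 less1)+
  have q1: "1 \<le> 2 * q t" for t using q(3)[of t] by linarith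
  note \<phi>pos = pos[OF q1]
  define w where "w t = real (2 * q t) * \<phi> (2 * q t)" for t
  have ge: "w s \<le> w t" if "s \<le> t" for s t
    using monoD[OF q(1) that] q1[of s] q1[of t] \<phi>pos[of s]
    unfolding w_def by (intro mult_mono mono_onD[OF mono]) auto
  have den: "0 < w t" for t
    unfolding w_def using q(3)[of t] \<phi>pos[of t] by simp
  define r where "r t = \<epsilon> / w t" for t
  show "\<exists>c>0. \<forall>n0. c \<le> measure lborel
    {s \<in> {0..1}. \<exists>n\<ge>n0. 1 \<le> n \<and> real n * \<phi> n * dist_int (real n * \<theta> - s) < \<epsilon>}"
  proof (rule measure_orbit_hits_ge[where N = q and r = r and A = 8 and B = "\<lambda>_ _. 1" and K = 3, OF mono pos q])
    show r_pos: "0 < r t" for t unfolding r_def using den[of t] \<epsilon> by simp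
    show "r t \<le> 1 / 2" for t
    proof -
      have "2 * \<phi> 1 \<le> w t"
        unfolding w_def using q(3)[of t] q1[of t] pos[of 1] by (intro mult_mono mono_onD[OF mono]) auto
      then have "2 * \<epsilon> \<le> w t" using \<epsilon> by linarith
      then show ?thesis unfolding r_def using den[of t] by (simp add: divide_le_eq)
    qed
    show "r t \<le> r s" if "s \<le> t" for s t
      unfolding r_def using ge[OF that] den \<epsilon> by (intro divide_left_mono mult_pos_pos) auto
    show "real (2 * q t) * \<phi> (2 * q t) * r t \<le> \<epsilon>" for t
      unfolding r_def w_def[symmetric] using den[of t] by simp
    show "real (card {n \<in> {q t..<q t + q t}. dist_int (real n * \<theta> - x) < 2 * r s}) \<le> 8 * r s * real (q t) + 1"
      if "s \<le> t" for s t x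
      using card_window_le[OF separating_cf_denom[OF irr pos0 less1, of t], of "2 * r s" "q t" "q t" x] r_pos[of s]
      by (simp add: q_def)
    have "(\<Sum>s\<le>t. q s) \<le> 3 * q t" for t
      unfolding q_def by (rule sum_cf_denom_le[OF irr pos0 less1])
    then have "real (\<Sum>s\<le>t. q s) \<le> real (3 * q t)" for t by (rule of_nat_mono)
    then show "(\<Sum>s\<le>t. real (q s) * 1) \<le> 3 * real (q t)" for t by simp
    show "\<not> summable (\<lambda>t. real (q t) * r t)"
    proof
      assume "summable (\<lambda>t. real (q t) * r t)"
      moreover have "real (q t) * r t = \<epsilon> / 2 * (1 / \<phi> (2 * q t))" for t
        unfolding r_def w_def using q(3)[of t] by simp
      ultimately have sm: "summable (\<lambda>t. 1 / \<phi> (2 * q t))"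
        using \<epsilon> by (simp only: summable_cmult_iff) simp
      \<comment> \<open>\<open>M\<close> dominates \<open>C\<close>, and the extra power in
        \<open>M ^ Suc k\<close> pays for the factor 2.\<close>
      define M where "M = 2 + nat \<lceil>C\<rceil>"
      have M: "2 \<le> M" by (simp add: M_def)
      have le: "2 * q k \<le> M ^ Suc k" for k
      proof -
        have "0 \<le> C" using C[of 1] of_nat_0_le_iff[of "cf_denom \<theta> 1", where 'a = real] by simp
        then have "C ^ k \<le> real M ^ k" unfolding M_def by (intro power_mono) linarith+
        then have "real (q k) \<le> real (M ^ k)" unfolding q_def of_nat_power using C[of k] by linarith
        then have "q k \<le> M ^ k" unfolding of_nat_le_iff .
        then show ?thesis using mult_mono[OF M] by simp
      qed
      have "summable (\<lambda>k. 1 / \<phi> (M ^ Suc k))"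
      proof (rule summable_comparison_test'[OF sm])
        fix k
        have "\<phi> (2 * q k) \<le> \<phi> (M ^ Suc k)"
          using le[of k] q1[of k] order_trans[OF q1[of k] le[of k]] by (intro mono_onD[OF mono]) auto
        then show "norm (1 / \<phi> (M ^ Suc k)) \<le> 1 / \<phi> (2 * q k)"
          using \<phi>pos[of k] by (simp add: frac_le)
      qed
      then have "summable (\<lambda>k. 1 / \<phi> (M ^ k))" by (rule summable_Suc_iff[THEN iffD1])
      then show False using not_summable_geometric_subsequence[OF mono pos div M] by contradiction
    qed
  qed simp_all
qed

text \<open>Fix the later scale \<open>t\<close> and the denominator \<open>q (\<kappa> t)\<close>
  just below \<open>2 * N t\<close>. If \<open>2 * N s\<close> is below that denominator, the block
  is cut into windows of its length. Otherwise the growth condition makes \<open>r s\<close> so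
  small against \<open>1 / q (Suc (\<kappa> t))\<close> that at most two points are counted.\<close>

lemma AE_liminf_log_quotients:
  assumes D: "\<forall>\<^sub>F k in sequentially.
      real (cf_denom \<theta> (Suc k)) / real (cf_denom \<theta> k) \<le> D * ln (real (cf_denom \<theta> k))"
  shows "AE s in lebesgue. liminf (\<lambda>n. ereal (real n * \<phi> n * dist_int (real n * \<theta> - s))) = 0"
proof -
  define q where "q = cf_denom \<theta>"
  have q: "mono q" "\<And>t. t \<le> q t" "\<And>t. 0 < q t"
    unfolding q_def by (rule mono_cf_denom cf_denom_ge cf_denom_pos; fact irr pos0 less1)+
  define D' where "D' = max D 1"
  have D': "1 \<le> D'" "D \<le> D'" by (simp_all add: D'_def)
  obtain K where K0: "\<And>k. k \<ge> K \<Longrightarrow> real (q (Suc k)) / real (q k) \<le> D * ln (real (q k))"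
    using D unfolding eventually_sequentially q_def by blast
  have K: "real (q (Suc k)) \<le> D' * (real (q k) * ln (real (q k)))" if "k \<ge> K" for k
  proof -
    have "real (q (Suc k)) / real (q k) \<le> D * ln (real (q k))" by (rule K0[OF that])
    also have "\<dots> \<le> D' * ln (real (q k))" using D' q(3)[of k] by (intro mult_right_mono) auto
    finally show ?thesis using q(3)[of k] by (simp add: field_simps)
  qed
  \<comment> \<open>Enlarging \<phi> only shrinks the radii; the logarithm is what lets
    \<open>w s\<close> dominate the growth bound for the next denominator.\<close>
  define \<phi>' where "\<phi>' n = max (\<phi> n) (ln (real n))" for n
  have mono': "mono_on {1..} \<phi>'"
    unfolding \<phi>'_def by (intro mono_onI max.mono mono_onD[OF mono]) auto
  have pos': "0 < \<phi>' n" if "1 \<le> n" for n using pos[OF that] by (simp add: \<phi>'_def less_max_iff_disj)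
  \<comment> \<open>Starting at this power makes every scale exceed \<open>q K\<close>, so that
    \<open>\<kappa> t \<ge> K\<close> and the growth condition is available.\<close>
  define a where "a = q K"
  define N where "N t = (2::nat) ^ (t + a)" for t
  have N: "mono N" "\<And>t. t \<le> N t" "\<And>t. 0 < N t"
  proof -
    show "mono N" unfolding N_def by (intro monoI power_increasing) auto
    show "t \<le> N t" for t
      unfolding N_def using less_exp[of "t + a"] by linarith
    show "0 < N t" for t by (simp add: N_def)
  qed
  have qK: "q K \<le> N t" for t
    unfolding N_def using less_exp[of "t + a"] a_def by linarith
  have "\<exists>k\<ge>K. q k \<le> 2 * N t \<and> 2 * N t < q (Suc k)" for t
  proof -
    let ?P = "\<lambda>j. 2 * N t < q j"
    have "?P (Suc (2 * N t))" using q(2)[of "Suc (2 * N t)"] by linarith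
    then have L: "?P (LEAST j. ?P j)" by (rule LeastI)
    have "K < (LEAST j. ?P j)"
    proof (rule ccontr)
      assume "\<not> K < (LEAST j. ?P j)"
      then have "q (LEAST j. ?P j) \<le> q K" by (intro monoD[OF q(1)]) simp
      then show False using L qK[of t] by linarith
    qed
    then obtain k where k: "(LEAST j. ?P j) = Suc k" "K \<le> k" by (cases "LEAST j. ?P j") auto
    then have "\<not> ?P k" using not_less_Least[of k ?P] by simp
    then show ?thesis using k L by auto
  qed
  then obtain \<kappa> where \<kappa>: "\<And>t. K \<le> \<kappa> t" "\<And>t. q (\<kappa> t) \<le> 2 * N t" "\<And>t. 2 * N t < q (Suc (\<kappa> t))"
    by metis
  \<comment> \<open>The first bound keeps the radii at most 1/2; the second gives
    \<open>r s * q (Suc (\<kappa> t)) \<le> 1 / 8\<close> in the short-range case below.\<close>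
  define \<delta> where "\<delta> = min (\<phi> 1) (1 / (8 * D'))"
  have \<delta>: "0 < \<delta>" "\<delta> \<le> \<phi> 1" "\<delta> \<le> 1 / (8 * D')" using pos[of 1] D' by (auto simp: \<delta>_def)
  have N1: "1 \<le> 2 * N t" for t using N(3)[of t] by linarith
  note \<phi>pos = pos'[OF N1]
  define w where "w t = real (2 * N t) * \<phi>' (2 * N t)" for t
  have ge: "w s \<le> w t" if "s \<le> t" for s t
    using monoD[OF N(1) that] N1[of s] N1[of t] \<phi>pos[of s]
    unfolding w_def by (intro mult_mono mono_onD[OF mono']) auto
  have den: "0 < w t" for t
    unfolding w_def using N(3)[of t] \<phi>pos[of t] by simp
  show ?thesis
  proof (rule AE_liminf_eq_0[OF irr mono pos \<delta>(1)])
    fix \<epsilon> :: real assume \<epsilon>: "0 < \<epsilon>" "\<epsilon> \<le> \<delta>"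
    define r where "r t = \<epsilon> / w t" for t
    \<comment> \<open>The 2 covers the short-range case; the other term counts the windows of length
      \<open>q (\<kappa> t)\<close> in the block, where \<open>q (\<kappa> t) \<le> 2 * N t\<close>
      absorbs the final incomplete window into the factor 3.\<close>
    define B where "B s t = 2 + (if 2 * N s < q (\<kappa> t) then 3 * real (N t) / real (q (\<kappa> t)) else 0)" for s t
    have r_pos: "0 < r t" for t unfolding r_def using den[of t] \<epsilon> by simp
    have count: "real (card {n \<in> {N t..<N t + N t}. dist_int (real n * \<theta> - x) < 2 * r s})
        \<le> 24 * r s * real (N t) + B s t" (is "real ?c \<le> _") if st: "s \<le> t" for s t x
    proof (cases "2 * N s < q (\<kappa> t)")
      case True
      let ?q = "real (q (\<kappa> t))"
      have q0: "0 < ?q" using q(3) by simp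
      have "real ?c \<le> (real (N t) / ?q + 1) * (4 * (2 * r s) * ?q + 1)"
        unfolding q_def using r_pos[of s]
        by (intro card_long_window_le separating_cf_denom[OF irr pos0 less1]) auto
      also have "\<dots> \<le> (3 * real (N t) / ?q) * (4 * (2 * r s) * ?q + 1)"
      proof (intro mult_right_mono)
        have "?q \<le> real (2 * N t)" using \<kappa>(2)[of t] by (rule of_nat_mono)
        then show "real (N t) / ?q + 1 \<le> 3 * real (N t) / ?q" using q0 by (simp add: field_simps)
      qed (use r_pos[of s] q0 in simp)
      also have "\<dots> = 24 * r s * real (N t) + 3 * real (N t) / ?q" using q0 by (simp add: field_simps)
      finally show ?thesis using True by (simp add: B_def)
    next
      case False
      then have qN: "q (\<kappa> t) \<le> 2 * N s" by simp
      let ?q = "real (q (Suc (\<kappa> t)))"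
      have "?q \<le> D' * (real (q (\<kappa> t)) * ln (real (q (\<kappa> t))))" by (rule K[OF \<kappa>(1)])
      also have "\<dots> \<le> D' * w s"
        unfolding w_def
      proof (intro mult_left_mono mult_mono)
        have "ln (real (q (\<kappa> t))) \<le> ln (real (2 * N s))"
          using qN q(3)[of "\<kappa> t"] N(3)[of s] by (subst ln_le_cancel_iff) auto
        then show "ln (real (q (\<kappa> t))) \<le> \<phi>' (2 * N s)" by (simp add: \<phi>'_def le_max_iff_disj)
        show "real (q (\<kappa> t)) \<le> real (2 * N s)" using qN by (rule of_nat_mono)
      qed (use D' q(3)[of "\<kappa> t"] in auto)
      finally have "r s * ?q \<le> r s * (D' * w s)"
        using r_pos[of s] by (intro mult_left_mono) auto
      also have "\<dots> = \<epsilon> * D'" unfolding r_def using den[of s] by simp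
      also have "\<dots> \<le> 1 / 8" using mult_right_mono[OF order_trans[OF \<epsilon>(2) \<delta>(3)], of D'] D' by simp
      finally have rq: "8 * (r s * ?q) \<le> 1" by simp
      \<comment> \<open>The block has length \<open>N t < q (Suc (\<kappa> t))\<close>, so it is a
        single window for the next denominator.\<close>
      have "real ?c \<le> 4 * (2 * r s) * ?q + 1"
        unfolding q_def using r_pos[of s] \<kappa>(3)[of t]
        by (intro card_window_le separating_cf_denom[OF irr pos0 less1]) (auto simp: q_def)
      also have "\<dots> \<le> 2" using rq by simp
      also have "\<dots> \<le> 24 * r s * real (N t) + B s t" using r_pos[of s] by (simp add: B_def)
      finally show ?thesis .
    qed
    show "\<exists>c>0. \<forall>n0. c \<le> measure lborel
      {s \<in> {0..1}. \<exists>n\<ge>n0. 1 \<le> n \<and> real n * \<phi> n * dist_int (real n * \<theta> - s) < \<epsilon>}"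
    proof (rule measure_orbit_hits_ge[where N = N and r = r and A = 24 and B = B and K = 7, OF mono pos N r_pos])
      show "r t \<le> 1 / 2" for t
      proof -
        have "\<phi> 1 \<le> \<phi>' (2 * N t)"
          using mono_onD[OF mono, of 1 "2 * N t"] N1[of t] by (simp add: \<phi>'_def le_max_iff_disj)
        then have "2 * \<phi> 1 \<le> w t"
          unfolding w_def using N(3)[of t] pos[of 1] by (intro mult_mono) auto
        then have "2 * \<epsilon> \<le> w t" using \<epsilon> \<delta> by linarith
        then show ?thesis unfolding r_def using den[of t] by (simp add: divide_le_eq)
      qed
      show "r t \<le> r s" if "s \<le> t" for s t
        unfolding r_def using ge[OF that] den \<epsilon> by (intro divide_left_mono mult_pos_pos) auto
      show "real (2 * N t) * \<phi> (2 * N t) * r t \<le> \<epsilon>" for t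
      proof -
        have "real (2 * N t) * \<phi> (2 * N t) * r t \<le> w t * r t"
          unfolding w_def using r_pos[of t] by (intro mult_right_mono mult_left_mono) (auto simp: \<phi>'_def)
        also have "\<dots> = \<epsilon>" unfolding r_def using den[of t] by simp
        finally show ?thesis .
      qed
      show "0 \<le> B s t" for s t by (simp add: B_def)
      show "(\<Sum>s\<le>t. real (N s) * B s t) \<le> 7 * real (N t)" for t
      proof -
        let ?q = "q (\<kappa> t)"
        have "(\<Sum>s\<le>t. real (N s) * B s t)
            = (\<Sum>s\<le>t. 2 * real (N s) + 3 * real (N t) / real ?q * real (if 2 * N s < ?q then N s else 0))"
          by (intro sum.cong refl) (simp add: B_def algebra_simps)
        also have "\<dots> = 2 * real (\<Sum>s\<le>t. N s)
            + 3 * real (N t) / real ?q * real (\<Sum>s\<le>t. if 2 * N s < ?q then N s else 0)"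
          unfolding sum.distrib of_nat_sum sum_distrib_left ..
        \<comment> \<open>The denominator \<open>?q\<close> cancels because the restricted sum runs
          only over scales below it; hence the constant 4 + 3 = 7.\<close>
        also have "\<dots> \<le> 2 * real (2 * N t) + 3 * real (N t) / real ?q * real ?q"
          unfolding N_def by (intro add_mono mult_left_mono of_nat_mono sum_doubling_le sum_doubling_below_le) auto
        also have "\<dots> = 7 * real (N t)" using q(3)[of "\<kappa> t"] by simp
        finally show ?thesis .
      qed
      show "\<not> summable (\<lambda>t. real (N t) * r t)"
      proof
        assume "summable (\<lambda>t. real (N t) * r t)"
        moreover have "real (N t) * r t = \<epsilon> / 2 * (1 / \<phi>' (2 * N t))" for t
          unfolding r_def w_def using N(3)[of t] by simp
        ultimately have "summable (\<lambda>t. 1 / \<phi>' (2 * N t))"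
          using \<epsilon> by (simp only: summable_cmult_iff) simp
        moreover have "2 * N t = 2 ^ (t + Suc a)" for t by (simp add: N_def)
        ultimately have "summable (\<lambda>t. 1 / \<phi>' (2 ^ (t + Suc a)))" by simp
        then have "summable (\<lambda>j. 1 / \<phi>' (2 ^ j))"
          by (rule summable_iff_shift[where f = "\<lambda>j. 1 / \<phi>' (2 ^ j)", THEN iffD1])
        \<comment> \<open>Along powers of 2 the logarithm is linear in \<open>j\<close>, the form
          that \<open>not_summable_max_linear\<close> handles.\<close>
        moreover have "\<phi>' (2 ^ j) = max (\<phi> (2 ^ j)) (ln 2 * real j)" for j
          by (simp add: \<phi>'_def ln_realpow mult.commute)
        ultimately have "summable (\<lambda>j. 1 / max (\<phi> (2 ^ j)) (ln 2 * real j))" by simp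
        moreover have "\<not> summable (\<lambda>j. 1 / \<phi> (2 ^ j))"
          by (rule not_summable_geometric_subsequence[OF mono pos div]) auto
        then have "\<not> summable (\<lambda>j. 1 / max (\<phi> (2 ^ j)) (ln 2 * real j))"
          by (intro not_summable_max_linear monoI mono_onD[OF mono] pos) (auto intro: power_increasing)
        ultimately show False by contradiction
      qed
    qed (use count in simp_all)
  qed
qed

end

theorem theorem2:
  fixes \<theta> :: real
  assumes "\<theta> \<notin> \<rat>" and "0 < \<theta>" and "\<theta> < 1"
  shows
    "((\<exists>C::real. \<forall>k. real (cf_denom \<theta> k) \<le> C ^ k) \<longrightarrow>
       (\<forall>\<phi>::nat \<Rightarrow> real.
          mono_on {1..} \<phi> \<and> (\<forall>n\<ge>1. 0 < \<phi> n) \<and>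
          \<not> summable (\<lambda>n. 1 / (real (Suc n) * \<phi> (Suc n))) \<longrightarrow>
          (AE s in lebesgue.
             liminf (\<lambda>n. ereal (real n * \<phi> n * dist_int (real n * \<theta> - s))) = 0)))
     \<and>
     ((\<exists>D::real. \<forall>\<^sub>F k in sequentially.
         real (cf_denom \<theta> (Suc k)) / real (cf_denom \<theta> k) \<le> D * ln (real (cf_denom \<theta> k))) \<longrightarrow>
       (\<forall>\<phi>::nat \<Rightarrow> real.
          mono_on {1..} \<phi> \<and> (\<forall>n\<ge>1. 0 < \<phi> n) \<and>
          \<not> summable (\<lambda>n. 1 / (real (Suc n) * \<phi> (Suc n))) \<longrightarrow>
          (AE s in lebesgue.
             liminf (\<lambda>n. ereal (real n * \<phi> n * dist_int (real n * \<theta> - s))) = 0)))"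
  using AE_liminf_exponential_denoms[OF assms] AE_liminf_log_quotients[OF assms] by blast

end
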